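(* Let $n\geq 1$, $q\geq 2$ and let $\gamma$ be an integer. A completely regular code in $H(n,q)$ with covering radius $1$, eigenvalue $\lambda_2(n,q)$, parameter $\gamma$ and $\gamma\leq\beta$ exists if and only if one of the following holds: (1) $n\geq 2$ and $\gamma$ is even; (2) $n\geq 3$, $q$ is even, and $\frac{q}{2}\leq \gamma\leq q$; (3) $n\geq 3$, $q$ is even, $\gamma$ is odd, $\gamma\leq q/2$, and Condition 1 holds for $q$ and $\gamma$.
   Context: Let $\mathcal{A}$ be a set of size $q\geq 2$. The Hamming graph $H(n,q)$ has vertex set $\mathcal{A}^n$, two tuples being adjacent iff they differ in exactly one position; it is $n(q-1)$-regular and its eigenvalues are $\lambda_i(n,q)=n(q-1)-qi$, $i=0,\dots,n$. For a $k$-regular graph $\Gamma$, a set $C$ of vertices is a completely regular code with covering radius $1$ if $C$ is a nonempty proper subset of the vertex set and there are integers $\beta$ and $\gamma\geq 1$ such that every vertex of $C$ has exactly $\beta$ neighbours outside $C$ and every vertex outside $C$ has exactly $\gamma$ neighbours in $C$. Its eigenvalues are $k$ and $k-(\beta+\gamma)$ (eigenvalues of the intersection matrix $\begin{pmatrix}k-\beta&\beta\\ \gamma&k-\gamma\end{pmatrix}$); "the code has eigenvalue $\lambda$" (for $\lambda\neq k$) means $k-(\beta+\gamma)=\lambda$. Thus eigenvalue $\lambda_2(n,q)$ means $\beta+\gamma=2q$. Condition 1 (for $q$ and $\gamma$): there exist integers $r,s,t$ with $0<r,s,t<q$ and integers $a,b,c$ with $0<c\leq\min\{q-s,q-t\}$,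 $0<b\leq \min\{t,q-r\}$, $0<a\leq\min\{r,s\}$ such that $cr=a(q-t)$, $b(q-s)=c(q-r)$, $at=bs$, and $\gamma=a+b+c$.
   Formalization: In item (1) the condition is read as "n ≥ 2, γ is even and 1 ≤ γ ≤ q"; without this range the equivalence fails, e.g. for n = 2, q = 2, γ = 4, where β = 0 < γ, or for γ = 0. *)

theory Defs
  imports Complex_Main
begin

text \<open>
  A graph is given by a vertex set \<open>V\<close> and an adjacency relation \<open>E\<close>; only the restriction
  of \<open>E\<close> to \<open>V\<close> matters.
\<close>

definition regular_graph :: "'v set \<Rightarrow> ('v \<Rightarrow> 'v \<Rightarrow> bool) \<Rightarrow> nat \<Rightarrow> bool" where
  "regular_graph V E k \<longleftrightarrow>
     finite V \<and> (\<forall>v\<in>V. \<not> E v v) \<and> (\<forall>v\<in>V. \<forall>w\<in>V. E v w \<longrightarrow> E w v) \<and>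
     (\<forall>v\<in>V. card {w\<in>V. E v w} = k)"

text \<open>
  \<open>C\<close> is a completely regular code with covering radius 1 and parameters \<open>\<beta>\<close>, \<open>\<gamma>\<close>
  in the \<open>k\<close>-regular graph \<open>(V, E)\<close>.
\<close>

definition crc1 ::
  "'v set \<Rightarrow> ('v \<Rightarrow> 'v \<Rightarrow> bool) \<Rightarrow> nat \<Rightarrow> 'v set \<Rightarrow> int \<Rightarrow> int \<Rightarrow> bool" where
  "crc1 V E k C \<beta> \<gamma> \<longleftrightarrow>
     regular_graph V E k \<and> C \<noteq> {} \<and> C \<subset> V \<and> \<gamma> \<ge> 1 \<and>
     (\<forall>v\<in>C. int (card {w\<in>V - C. E v w}) = \<beta>) \<and>
     (\<forall>v\<in>V - C. int (card {w\<in>C. E v w}) = \<gamma>)"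

text \<open>
  The intersection matrix with rows \<open>(k - \<beta>, \<beta>)\<close> and \<open>(\<gamma>, k - \<gamma>)\<close> has the eigenvalues \<open>k\<close>
  and \<open>k - (\<beta> + \<gamma>)\<close>; the following predicate concerns the one different from \<open>k\<close>.
\<close>

definition crc1_has_eigenvalue :: "nat \<Rightarrow> int \<Rightarrow> int \<Rightarrow> int \<Rightarrow> bool" where
  "crc1_has_eigenvalue k \<beta> \<gamma> \<mu> \<longleftrightarrow> \<mu> \<noteq> int k \<and> int k - (\<beta> + \<gamma>) = \<mu>"

definition hamming_vertices :: "nat \<Rightarrow> 'a set \<Rightarrow> 'a list set" where
  "hamming_vertices n A = {x. length x = n \<and> set x \<subseteq> A}"

definition hamming_adj :: "nat \<Rightarrow> 'a list \<Rightarrow> 'a list \<Rightarrow> bool" where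
  "hamming_adj n x y \<longleftrightarrow> card {i. i < n \<and> x ! i \<noteq> y ! i} = 1"

definition hamming_degree :: "nat \<Rightarrow> nat \<Rightarrow> nat" where
  "hamming_degree n q = n * (q - 1)"

definition hamming_eigenvalue :: "nat \<Rightarrow> nat \<Rightarrow> nat \<Rightarrow> int" where
  "hamming_eigenvalue i n q = int n * (int q - 1) - int q * int i"

definition condition1 :: "int \<Rightarrow> int \<Rightarrow> bool" where
  "condition1 q \<gamma> \<longleftrightarrow>
     (\<exists>r s t a b c :: int.
        0 < r \<and> r < q \<and> 0 < s \<and> s < q \<and> 0 < t \<and> t < q \<and>
        0 < c \<and> c \<le> min (q - s) (q - t) \<and>
        0 < b \<and> b \<le> min t (q - r) \<and>
        0 < a \<and> a \<le> min r s \<and>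
        c * r = a * (q - t) \<and> b * (q - s) = c * (q - r) \<and> a * t = b * s \<and>
        \<gamma> = a + b + c)"

lemma hamming_neighbours:
  assumes "x \<in> hamming_vertices n A"
  shows "{y \<in> hamming_vertices n A. hamming_adj n x y} =
         (\<lambda>(i, a). x[i := a]) ` (SIGMA i:{..<n}. A - {x ! i})"
proof (intro equalityI subsetI)
  fix y assume "y \<in> {y \<in> hamming_vertices n A. hamming_adj n x y}"
  then have y: "length y = n" "set y \<subseteq> A" and "card {i. i < n \<and> x ! i \<noteq> y ! i} = 1"
    by (auto simp: hamming_vertices_def hamming_adj_def)
  then obtain i where i: "{i. i < n \<and> x ! i \<noteq> y ! i} = {i}"
    by (auto simp: card_1_singleton_iff)
  then have "i < n" and ne: "x ! i \<noteq> y ! i" by blast+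
  have "x ! j = y ! j" if "j < n" "j \<noteq> i" for j
    using i that by blast
  then have "y = x[i := y ! i]"
    using y(1) assms \<open>i < n\<close>
    by (intro nth_equalityI) (auto simp: hamming_vertices_def nth_list_update)
  moreover have "y ! i \<in> A - {x ! i}"
    using ne y \<open>i < n\<close> by (auto simp: subset_iff in_set_conv_nth)
  ultimately show "y \<in> (\<lambda>(i, a). x[i := a]) ` (SIGMA i:{..<n}. A - {x ! i})"
    using \<open>i < n\<close> by (intro image_eqI[of _ _ "(i, y ! i)"]) auto
next
  fix y assume "y \<in> (\<lambda>(i, a). x[i := a]) ` (SIGMA i:{..<n}. A - {x ! i})"
  then obtain i a where ia: "i < n" "a \<in> A" "a \<noteq> x ! i" "y = x[i := a]" by auto
  have l: "length x = n" using assms by (simp add: hamming_vertices_def)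
  have "{j. j < n \<and> x ! j \<noteq> y ! j} = {i}"
    using ia l by (auto simp: nth_list_update split: if_splits)
  moreover have "y \<in> hamming_vertices n A"
    using ia assms set_update_subset_insert[of x i a] by (auto simp: hamming_vertices_def)
  ultimately show "y \<in> {y \<in> hamming_vertices n A. hamming_adj n x y}"
    by (simp add: hamming_adj_def)
qed

lemma hamming_regular:
  assumes "finite A"
  shows "regular_graph (hamming_vertices n A) (hamming_adj n) (hamming_degree n (card A))"
proof -
  have "card {y \<in> hamming_vertices n A. hamming_adj n x y} = n * (card A - 1)"
    if x: "x \<in> hamming_vertices n A" for x
  proof -
    have l: "length x = n" and A: "\<And>i. i < n \<Longrightarrow> x ! i \<in> A"
      using x by (auto simp: hamming_vertices_def)
    have "inj_on (\<lambda>(i, a). x[i := a]) (SIGMA i:{..<n}. A - {x ! i})"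
    proof (rule inj_onI)
      fix p p'
      assume "p \<in> (SIGMA i:{..<n}. A - {x ! i})" "p' \<in> (SIGMA i:{..<n}. A - {x ! i})"
        and "(\<lambda>(i, a). x[i := a]) p = (\<lambda>(i, a). x[i := a]) p'"
      then obtain i a j b where p: "p = (i, a)" "p' = (j, b)"
        and *: "i < n" "a \<noteq> x ! i" "j < n" "b \<noteq> x ! j" "x[i := a] = x[j := b]"
        by auto
      have "i = j"
        using * l by (metis nth_list_update_eq nth_list_update_neq)
      moreover have "a = b"
        using * l \<open>i = j\<close> by (metis nth_list_update_eq)
      ultimately show "p = p'" by (simp add: p)
    qed
    then have "card {y \<in> hamming_vertices n A. hamming_adj n x y} =
        (\<Sum>i<n. card (A - {x ! i}))"
      unfolding hamming_neighbours[OF x] using assms by (simp add: card_image)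
    also have "\<dots> = n * (card A - 1)" using A by (simp add: card_Diff_singleton)
    finally show ?thesis .
  qed
  moreover have "finite (hamming_vertices n A)"
    using finite_lists_length_eq[OF assms, of n]
    by (simp add: hamming_vertices_def conj_commute)
  moreover have "hamming_adj n y x" if "hamming_adj n x y" for x y :: "'a list"
    using that by (simp add: hamming_adj_def eq_commute)
  moreover have "\<not> hamming_adj n x x" for x :: "'a list"
    by (simp add: hamming_adj_def)
  ultimately show ?thesis by (auto simp: regular_graph_def hamming_degree_def)
qed

end

theory Submission
  imports Defs "HOL-Library.FuncSet"
begin

text \<open>
  Let \<open>f\<close> be the indicator function of \<open>C\<close> and let \<open>L i f x\<close> be the sum of \<open>f\<close> over the line
  through \<open>x\<close> in direction \<open>i\<close>. For \<open>\<beta> + \<gamma> = 2 q\<close> the code property says precisely that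
  \<open>(\<Sum>i<n. L i f x) = (n - 2) q f x + \<gamma>\<close> for all \<open>x\<close>. A maximum principle shows that all mixed
  third differences of \<open>f\<close> vanish, so the difference of two parallel layers of \<open>f\<close> is a sum of
  functions of one coordinate; being \<open>{-1, 0, 1}\<close>-valued it depends on at most two coordinates.

  Summing over all \<open>x\<close> gives that \<open>q\<close> is even for odd \<open>\<gamma>\<close>. Let \<open>\<gamma>\<close> be odd and \<open>2 \<gamma> < q\<close>.
  If no layer difference depended on two coordinates, then \<open>f\<close> would depend on two coordinates only
  and \<open>\<gamma>\<close> would be even. Otherwise sparseness forces both layers of such a pair to contain full
  hyperplanes, in different directions \<open>j\<close> and \<open>k\<close>, and no layer contains full hyperplanes in two
  directions. It follows that every layer is a union of hyperplanes in direction \<open>j\<close> or \<open>k\<close>,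
  together with a common remainder, which by the third differences depends on the coordinates
  \<open>j\<close> and \<open>k\<close> only. So \<open>C\<close> consists of lines in three directions, and counting them
  yields Condition 1. Conversely, all codes are built from biregular bipartite graphs
  between parts of \<open>A\<close>.
\<close>

section \<open>Bounded integer functions with vanishing mixed differences\<close>

definition depends_on :: "'i set \<Rightarrow> (('i \<Rightarrow> 'a) \<Rightarrow> 'b) \<Rightarrow> bool" where
  "depends_on S g \<longleftrightarrow> (\<forall>x y. (\<forall>i\<in>S. x i = y i) \<longrightarrow> g x = g y)"

lemma depends_onD: "depends_on S g \<Longrightarrow> (\<And>i. i \<in> S \<Longrightarrow> x i = y i) \<Longrightarrow> g x = g y"
  by (auto simp: depends_on_def)

text \<open>Two points that agree on \<open>S\<close> are joined by changing the finitely many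
  coordinates in \<open>I - S\<close> one after the other; coordinates outside \<open>I\<close> do
  not affect \<open>g\<close>.\<close>

lemma depends_on_shrink:
  assumes "finite I" "depends_on I g"
    and upd: "\<And>i x a. i \<in> I - S \<Longrightarrow> g (x(i := a)) = g x"
  shows "depends_on S g"
  unfolding depends_on_def
proof (intro allI impI)
  fix x y :: "'a \<Rightarrow> 'b" assume xy: "\<forall>i\<in>S. x i = y i"
  have "g (\<lambda>i. if i \<in> T then y i else x i) = g x" if "T \<subseteq> I - S" for T
    using finite_subset[OF that] assms(1) that
  proof (induction T rule: infinite_finite_induct)
    case (insert i T)
    have "(\<lambda>l. if l \<in> insert i T then y l else x l) = (\<lambda>l. if l \<in> T then y l else x l)(i := y i)"
      by auto
    then show ?case using insert upd[of i] by simp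
  qed auto
  from this[of "I - S"] have "g (\<lambda>i. if i \<in> I - S then y i else x i) = g x" by simp
  moreover have "g (\<lambda>i. if i \<in> I - S then y i else x i) = g y"
    by (rule depends_onD[OF assms(2)]) (use xy in auto)
  ultimately show "g x = g y" by simp
qed

text \<open>Vanishing mixed differences make the effect of changing one coordinate independent of
  the others, so oscillations in different coordinates add up. Each coordinate that matters
  contributes at least 1, while the range from -1 to 1 has width 2.\<close>

lemma separable_cases:
  fixes d :: "('i \<Rightarrow> 'a) \<Rightarrow> int"
  assumes fin: "finite J" and dep: "depends_on J d"
    and bnd: "\<And>x. \<bar>d x\<bar> \<le> 1"
    and mixed: "\<And>j k x b c. j \<in> J \<Longrightarrow> k \<in> J \<Longrightarrow> j \<noteq> k \<Longrightarrow>
      d (x(j := b, k := c)) = d (x(j := b)) + d (x(k := c)) - d x"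
  obtains (const) "depends_on {} d"
    | (one) j where "j \<in> J" "depends_on {j} d"
    | (two) j k X Y where "j \<in> J" "k \<in> J" "j \<noteq> k"
        "\<And>x. d x = of_bool (x j \<in> X) - of_bool (x k \<in> Y)"
        "X \<noteq> {}" "X \<noteq> UNIV" "Y \<noteq> {}" "Y \<noteq> UNIV"
proof -
  define E where "E = {j \<in> J. \<exists>x a. d (x(j := a)) \<noteq> d x}"
  have depE: "depends_on E d"
    by (rule depends_on_shrink[OF fin dep]) (auto simp: E_def)
  have step: "\<exists>a a'. \<forall>x. d (x(j := a)) - d (x(j := a')) \<ge> 1" if "j \<in> E" for j
  proof -
    obtain y e where ye: "d (y(j := e)) \<noteq> d y" and jJ: "j \<in> J" using \<open>j \<in> E\<close> by (auto simp: E_def)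
    \<comment> \<open>The increment from \<open>y j\<close> to \<open>e\<close> depends on no
      coordinate, so its sign at one point is its sign everywhere.\<close>
    have shift: "d (x(j := e)) - d (x(j := y j)) = d (y(j := e)) - d y" for x
    proof -
      have "depends_on {} (\<lambda>x. d (x(j := e)) - d (x(j := y j)))"
      proof (rule depends_on_shrink[OF fin])
        show "depends_on J (\<lambda>x. d (x(j := e)) - d (x(j := y j)))"
          unfolding depends_on_def by (intro allI impI arg_cong2[of _ _ _ _ "(-)"] depends_onD[OF dep]) auto
        fix i x a assume "i \<in> J - {}"
        show "d ((x(i := a))(j := e)) - d ((x(i := a))(j := y j)) = d (x(j := e)) - d (x(j := y j))"
        proof (cases "i = j")
          case False
          then show ?thesis using mixed[of i j x a e] mixed[of i j x a "y j"] \<open>i \<in> J - {}\<close> jJ by simp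
        qed simp
      qed
      then have "d (x(j := e)) - d (x(j := y j)) = d (y(j := e)) - d (y(j := y j))"
        by (rule depends_onD) simp
      then show ?thesis by simp
    qed
    show ?thesis
    proof (cases "d (y(j := e)) > d y")
      case True
      then show ?thesis using shift by (intro exI[of _ e] exI[of _ "y j"]) auto
    next
      case False
      then show ?thesis using shift ye
        by (intro exI[of _ "y j"] exI[of _ e]) (smt (verit, best))
    qed
  qed
  consider "E = {}" | j where "E = {j}" | j k where "j \<in> E" "k \<in> E" "j \<noteq> k" by blast
  then show thesis
  proof cases
    case 1
    then show ?thesis using const depE by simp
  next
    case 2
    then show ?thesis using one[of j] depE by (auto simp: E_def)
  next
    case 3
    then have J: "j \<in> J" "k \<in> J" by (auto simp: E_def)
    obtain a a' where a: "\<And>x. d (x(j := a)) - d (x(j := a')) \<ge> 1" using step[OF 3(1)] by blast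
    obtain b b' where b: "\<And>x. d (x(k := b)) - d (x(k := b')) \<ge> 1" using step[OF 3(2)] by blast
    have Ejk: "E = {j, k}"
    proof (rule ccontr)
      assume "E \<noteq> {j, k}"
      then obtain m where m: "m \<in> E" "m \<noteq> j" "m \<noteq> k" using 3 by blast
      obtain c c' where c: "\<And>x. d (x(m := c)) - d (x(m := c')) \<ge> 1" using step[OF m(1)] by blast
      fix x :: "'i \<Rightarrow> 'a"
      \<comment> \<open>Three rises of at least 1, one coordinate after another, exceed the width
        2.\<close>
      have "d (x(j := a, k := b, m := c)) - d (x(j := a', k := b', m := c')) \<ge> 3"
        using c[of "x(j := a, k := b)"] b[of "x(j := a, m := c')"] a[of "x(k := b', m := c')"] m 3(3)
        by (simp add: fun_upd_twist)
      then show False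
        using bnd[of "x(j := a, k := b, m := c)"] bnd[of "x(j := a', k := b', m := c')"] by linarith
    qed
    define v where "v c e = d ((\<lambda>_. undefined)(j := c, k := e))" for c e
    have dv: "d x = v (x j) (x k)" for x
      unfolding v_def by (rule depends_onD[OF depE]) (use Ejk 3(3) in auto)
    have va: "v a e - v a' e \<ge> 1" for e
      using a[of "(\<lambda>_. undefined)(k := e)"] 3(3) by (simp add: v_def fun_upd_twist)
    have vb: "v c b - v c b' \<ge> 1" for c
      using b[of "(\<lambda>_. undefined)(j := c)"] by (simp add: v_def)
    have vmix: "v c e = v c b + v a e - v a b" for c e
      using mixed[OF J 3(3), of "(\<lambda>_. undefined)(j := a, k := b)" c e] 3(3)
      by (simp add: v_def fun_upd_twist)
    have vbnd: "\<bar>v c e\<bar> \<le> 1" for c e unfolding v_def by (rule bnd)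
    \<comment> \<open>Two rises of at least 1 lead from \<open>v a' b'\<close> to
      \<open>v a b\<close>, hence from -1 through 0 to 1.\<close>
    have vab: "v a b = 1" "v a' b = 0" "v a b' = 0"
      using va[of b] va[of b'] vb[of a] vb[of a'] vbnd[of a b] vbnd[of a' b'] vbnd[of a' b] vbnd[of a b']
      by linarith+
    have "v c b = 0 \<or> v c b = 1" for c using vb[of c] vbnd[of c b] vbnd[of c b'] by linarith
    moreover have "v a e = 0 \<or> v a e = 1" for e using va[of e] vbnd[of a e] vbnd[of a' e] by linarith
    \<comment> \<open>As \<open>v a b = 1\<close>, \<open>vmix\<close> reads
      \<open>v c e = v c b - (1 - v a e)\<close>, a difference of two values in {0, 1}.\<close>
    ultimately have "d x = of_bool (x j \<in> {c. v c b = 1}) - of_bool (x k \<in> {e. v a e = 0})" for x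
      using dv[of x] vmix[of "x j" "x k"] vab
      by (smt (verit, ccfv_threshold) mem_Collect_eq of_bool_eq(1,2))
    then show ?thesis
      using vab by (intro two[OF J 3(3), of "{c. v c b = 1}" "{e. v a e = 0}"]) (auto simp: set_eq_iff intro: exI[of _ a'] exI[of _ b])
  qed
qed

subsection \<open>Line sums and differences\<close>

definition line_sum :: "'a set \<Rightarrow> 'i \<Rightarrow> (('i \<Rightarrow> 'a) \<Rightarrow> int) \<Rightarrow> ('i \<Rightarrow> 'a) \<Rightarrow> int" where
  "line_sum A m g x = (\<Sum>a\<in>A. g (x(m := a)))"

definition diff_op :: "'i \<Rightarrow> 'a \<Rightarrow> (('i \<Rightarrow> 'a) \<Rightarrow> int) \<Rightarrow> ('i \<Rightarrow> 'a) \<Rightarrow> int" where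
  "diff_op i a g x = g x - g (x(i := a))"

lemma line_sum_upd [simp]: "line_sum A m g (x(m := a)) = line_sum A m g x"
  by (simp add: line_sum_def)

lemma line_sum_diff_op:
  "m \<noteq> i \<Longrightarrow> line_sum A m (diff_op i a g) x = diff_op i a (line_sum A m g) x"
  by (simp add: line_sum_def diff_op_def sum_subtractf fun_upd_twist)

lemma line_sum_insensitive:
  assumes "\<And>a. g (x(m := a)) = g x"
  shows "line_sum A m g x = int (card A) * g x"
  using assms by (simp add: line_sum_def)

text \<open>The line in direction \<open>i\<close> is common to \<open>x\<close> and
  \<open>x(i := a)\<close>, so its sum cancels, and so does the constant. Each difference thus
  removes one direction but keeps the factor \<kappa>.\<close>

lemma line_sums_diff_op:
  assumes fin: "finite J" "i \<in> J"
    and eq: "\<And>x. (\<Sum>m\<in>J. line_sum A m g x) = \<kappa> * g x + \<gamma>"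
  shows "(\<Sum>m\<in>J - {i}. line_sum A m (diff_op i a g) x) = \<kappa> * diff_op i a g x"
proof -
  have "(\<Sum>m\<in>J - {i}. line_sum A m (diff_op i a g) x) =
      (\<Sum>m\<in>J - {i}. line_sum A m g x - line_sum A m g (x(i := a)))"
    by (intro sum.cong refl) (auto simp: line_sum_diff_op diff_op_def)
  also have "\<dots> = (\<Sum>m\<in>J. line_sum A m g x - line_sum A m g (x(i := a)))"
    using fin by (simp add: sum.remove[of J i])
  also have "\<dots> = \<kappa> * diff_op i a g x"
    by (simp add: sum_subtractf eq diff_op_def algebra_simps)
  finally show ?thesis .
qed

text \<open>Maximum principle: compare both sides at a point where \<open>\<bar>g\<bar>\<close> is maximal.\<close>
lemma line_sums_eq_0:
  fixes g :: "('i \<Rightarrow> 'a) \<Rightarrow> int"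
  assumes bnd: "\<And>x. \<bar>g x\<bar> \<le> B"
    and eq: "\<And>x. (\<Sum>m\<in>J. line_sum A m g x) = \<kappa> * g x"
    and \<kappa>: "\<kappa> > int (card J) * int (card A)"
  shows "g x = 0"
proof -
  \<comment> \<open>Being bounded and integer-valued, \<open>g\<close> attains its largest absolute
    value even if the type \<open>'a\<close> is infinite.\<close>
  obtain y where y: "\<And>x. nat \<bar>g x\<bar> \<le> nat \<bar>g y\<bar>"
    using ex_has_greatest_nat[of "\<lambda>_. True" undefined "\<lambda>x. nat \<bar>g x\<bar>" "nat B + 1"] bnd
    by (metis add.commute le_imp_less_Suc nat_mono plus_1_eq_Suc)
  then have y: "\<bar>g x\<bar> \<le> \<bar>g y\<bar>" for x using nat_le_eq_zle by auto
  have "\<bar>line_sum A m g y\<bar> \<le> int (card A) * \<bar>g y\<bar>" for m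
    unfolding line_sum_def using y
    by (intro order_trans[OF sum_abs] sum_bounded_above[of A, THEN order_trans]) auto
  then have "\<bar>\<Sum>m\<in>J. line_sum A m g y\<bar> \<le> int (card J) * (int (card A) * \<bar>g y\<bar>)"
    by (intro order_trans[OF sum_abs] sum_bounded_above[of J, THEN order_trans]) auto
  moreover have "\<kappa> \<ge> 0" using \<kappa> by (smt (verit) of_nat_0_le_iff zero_le_mult_iff)
  ultimately have "\<kappa> * \<bar>g y\<bar> \<le> int (card J) * int (card A) * \<bar>g y\<bar>"
    by (simp add: eq abs_mult mult.assoc)
  then have "\<bar>g y\<bar> \<le> 0" using \<kappa> by (metis abs_ge_zero leD linorder_not_le mult_strict_right_mono)
  then show ?thesis using y[of x] by simp
qed

subsection \<open>Codes with the second eigenvalue\<close>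

text \<open>
  \<open>f\<close> is the indicator function of the code. The values at points outside \<open>A\<close> are irrelevant;
  assumption \<open>retract\<close> makes \<open>f\<close> total so that no side conditions \<open>x i \<in> A\<close> are needed.
\<close>
locale second_eigenvalue_code =
  fixes A :: "'a set" and I :: "'i set" and f :: "('i \<Rightarrow> 'a) \<Rightarrow> int" and \<gamma> :: int
  assumes finI: "finite I" and finA: "finite A"
    and range_f: "f x = 0 \<or> f x = 1"
    and depf: "depends_on I f"
    and retract: "\<exists>a'\<in>A. \<forall>i x. f (x(i := a)) = f (x(i := a'))"
    and lines: "(\<Sum>m\<in>I. line_sum A m f x) = (int (card I) - 2) * int (card A) * f x + \<gamma>"
begin

abbreviation "q \<equiv> int (card A)"

lemma q_pos: "q > 0"
  using retract[of undefined] finA by (auto simp: card_gt_0_iff)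

lemma line_nonneg: "line_sum A m f x \<ge> 0"
  unfolding line_sum_def using range_f by (intro sum_nonneg) (metis order_refl zero_le_one)

lemma line_ge_card:
  assumes "\<And>a. a \<in> B \<Longrightarrow> f (x(m := a)) = 1" "B \<subseteq> A"
  shows "line_sum A m f x \<ge> int (card B)"
proof -
  have "int (card B) = (\<Sum>a\<in>B. f (x(m := a)))" using assms(1) by simp
  also have "\<dots> \<le> line_sum A m f x"
    unfolding line_sum_def using assms(2) finA range_f
    by (intro sum_mono2) (auto, metis order_refl zero_le_one)
  finally show ?thesis .
qed

text \<open>The entry \<open>x m\<close> may lie outside \<open>A\<close>; \<open>retract\<close>
  supplies an entry in \<open>A\<close> with the same value of \<open>f\<close>.\<close>

lemma line_pos:
  assumes "f x = 1" shows "line_sum A m f x \<ge> 1"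
proof -
  obtain a where "a \<in> A" "f (x(m := x m)) = f (x(m := a))" using retract by blast
  then show ?thesis using line_ge_card[of "{a}" x m] assms by simp
qed

text \<open>After three differences \<open>card I - 3\<close> directions remain, but the factor is
  still \<open>(card I - 2) * q\<close>, so the maximum principle applies. The bound 8 comes from
  doubling the bound at each difference.\<close>

lemma mixed3:
  assumes "i \<in> I" "j \<in> I" "k \<in> I" "i \<noteq> j" "i \<noteq> k" "j \<noteq> k"
  shows "diff_op i a (diff_op j b (diff_op k c f)) x = 0"
proof -
  let ?\<kappa> = "(int (card I) - 2) * q"
  have "(\<Sum>m\<in>I - {k}. line_sum A m (diff_op k c f) x) = ?\<kappa> * diff_op k c f x" for x
    by (rule line_sums_diff_op[OF finI assms(3)]) (rule lines)
  then have "(\<Sum>m\<in>I - {k} - {j}. line_sum A m (diff_op j b (diff_op k c f)) x)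
      = ?\<kappa> * diff_op j b (diff_op k c f) x" for x
    using assms finI by (intro line_sums_diff_op[where \<gamma>=0]) auto
  then have "(\<Sum>m\<in>I - {k} - {j} - {i}. line_sum A m (diff_op i a (diff_op j b (diff_op k c f))) x)
      = ?\<kappa> * diff_op i a (diff_op j b (diff_op k c f)) x" for x
    using assms finI by (intro line_sums_diff_op[where \<gamma>=0]) auto
  moreover have "card (I - {k} - {j} - {i}) = card I - 3" "card I \<ge> 3"
  proof -
    show "card (I - {k} - {j} - {i}) = card I - 3" using assms finI by (simp add: card_Diff_singleton)
    have "card {i, j, k} = 3" using assms by simp
    then show "card I \<ge> 3" using card_mono[OF finI, of "{i, j, k}"] assms by simp
  qed
  then have "?\<kappa> > int (card (I - {k} - {j} - {i})) * q"
    using q_pos by (intro mult_strict_right_mono) (auto simp: of_nat_diff)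
  moreover have "\<bar>diff_op i a (diff_op j b (diff_op k c f)) x\<bar> \<le> 8" for x
  proof -
    have 1: "\<bar>diff_op k c f y\<bar> \<le> 2" for y
      using range_f[of y] range_f[of "y(k := c)"] by (auto simp: diff_op_def)
    have 2: "\<bar>diff_op j b (diff_op k c f) y\<bar> \<le> 4" for y
      using 1[of y] 1[of "y(j := b)"] unfolding diff_op_def[of j] by linarith
    show ?thesis
      using 2[of x] 2[of "x(i := a)"] unfolding diff_op_def[of i] by linarith
  qed
  ultimately show ?thesis by (rule line_sums_eq_0[rotated])
qed

text \<open>In contrast to \<open>diff_op\<close>, both layers are fixed, which makes the value
  independent of \<open>x i\<close>.\<close>

definition layer_diff :: "'i \<Rightarrow> 'a \<Rightarrow> 'a \<Rightarrow> ('i \<Rightarrow> 'a) \<Rightarrow> int" where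
  "layer_diff i z w x = f (x(i := z)) - f (x(i := w))"

lemma layer_diff_mixed:
  assumes "i \<in> I" "j \<in> I" "k \<in> I" "i \<noteq> j" "i \<noteq> k" "j \<noteq> k"
  shows "layer_diff i z w (x(j := b, k := c)) =
    layer_diff i z w (x(j := b)) + layer_diff i z w (x(k := c)) - layer_diff i z w x"
  using mixed3[OF assms, of w b c "x(i := z)"] assms
  by (simp add: diff_op_def layer_diff_def fun_upd_twist algebra_simps)

lemma layer_diff_lines:
  assumes "i \<in> I"
  shows "(\<Sum>m\<in>I - {i}. line_sum A m (layer_diff i z w) x) =
    (int (card I) - 2) * q * layer_diff i z w x"
proof -
  have "line_sum A m (layer_diff i z w) x = line_sum A m (diff_op i w f) (x(i := z))" if "m \<noteq> i" for m
    using that by (simp add: line_sum_def diff_op_def layer_diff_def fun_upd_twist)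
  moreover have "layer_diff i z w x = diff_op i w f (x(i := z))"
    by (simp add: diff_op_def layer_diff_def)
  ultimately show ?thesis
    using line_sums_diff_op[OF finI assms lines, of w "x(i := z)"] by simp
qed

text \<open>Each of the \<open>card I - 1 - card S\<close> directions outside \<open>S\<close> and
  different from \<open>i\<close> contributes \<open>q\<close> times the value, which lowers the
  factor from \<open>card I - 2\<close> to \<open>card S - 1\<close>. Used for \<open>S\<close> with
  at most two elements.\<close>

lemma layer_diff_lines_dep:
  assumes "i \<in> I" "S \<subseteq> I - {i}" "depends_on S (layer_diff i z w)"
  shows "(\<Sum>m\<in>S. line_sum A m (layer_diff i z w) x) =
    (int (card S) - 1) * q * layer_diff i z w x"
proof -
  have "line_sum A m (layer_diff i z w) x = q * layer_diff i z w x" if "m \<in> I - {i} - S" for m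
    using that by (intro line_sum_insensitive depends_onD[OF assms(3)]) auto
  then have "(\<Sum>m\<in>I - {i} - S. line_sum A m (layer_diff i z w) x)
      = int (card (I - {i} - S)) * (q * layer_diff i z w x)" by simp
  moreover have "card (I - {i} - S) + card S + 1 = card I"
    using assms(1,2) finI
    by (metis Suc_eq_plus1 card_Diff_subset card_Suc_Diff1 card_mono finite_Diff finite_subset le_add_diff_inverse2)
  then have "int (card (I - {i} - S)) = int (card I) - 1 - int (card S)" by simp
  moreover have "(\<Sum>m\<in>I - {i}. line_sum A m (layer_diff i z w) x) =
     (\<Sum>m\<in>I - {i} - S. line_sum A m (layer_diff i z w) x) + (\<Sum>m\<in>S. line_sum A m (layer_diff i z w) x)"
    using assms(2) finI by (intro sum.subset_diff) auto
  ultimately show ?thesis using layer_diff_lines[OF assms(1), of z w x] by (simp add: algebra_simps)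
qed

text \<open>The code equation keeps its form when irrelevant coordinates are dropped, since each of
  them contributes \<open>q * f x\<close>.\<close>

lemma lines_dep:
  assumes "S \<subseteq> I" "depends_on S f"
  shows "(\<Sum>m\<in>S. line_sum A m f x) = (int (card S) - 2) * q * f x + \<gamma>"
proof -
  have "line_sum A m f x = q * f x" if "m \<in> I - S" for m
    using that by (intro line_sum_insensitive depends_onD[OF assms(2)]) auto
  then have "(\<Sum>m\<in>I - S. line_sum A m f x) = int (card (I - S)) * (q * f x)" by simp
  moreover have "int (card (I - S)) = int (card I) - int (card S)"
    using assms(1) finI by (simp add: card_Diff_subset card_mono finite_subset of_nat_diff)
  moreover have "(\<Sum>m\<in>I. line_sum A m f x) =
     (\<Sum>m\<in>I - S. line_sum A m f x) + (\<Sum>m\<in>S. line_sum A m f x)"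
    using assms(1) finI by (intro sum.subset_diff) auto
  ultimately show ?thesis using lines[of x] by (simp add: algebra_simps)
qed

section \<open>Totals over all words, densities of layers, parity\<close>

definition total :: "(('i \<Rightarrow> 'a) \<Rightarrow> int) \<Rightarrow> int" where
  "total g = (\<Sum>x\<in>I \<rightarrow>\<^sub>E A. g x)"

lemma total_line_sum:
  assumes "i \<in> I"
  shows "total (line_sum A i g) = q * total g"
proof -
  let ?P = "I \<rightarrow>\<^sub>E A"
  have "total (line_sum A i g) = (\<Sum>(x, a)\<in>?P \<times> A. g (x(i := a)))"
    by (simp add: total_def line_sum_def sum.cartesian_product)
  \<comment> \<open>Exchanging the entry \<open>x i\<close> with \<open>a\<close> is an involution
    of \<open>?P \<times> A\<close> that turns \<open>g (x(i := a))\<close> into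
    \<open>g x\<close>.\<close>
  also have "\<dots> = (\<Sum>(x, a)\<in>?P \<times> A. g x)"
    using assms
    by (intro sum.reindex_bij_witness[where i = "\<lambda>(x, a). (x(i := a), x i)" and j = "\<lambda>(x, a). (x(i := a), x i)"])
      (auto simp: PiE_iff extensional_def)
  also have "\<dots> = q * total g"
    by (simp add: total_def sum_distrib_left flip: sum.cartesian_product)
  finally show ?thesis .
qed

lemma total_const: "total (\<lambda>_. c) = q ^ card I * c"
  by (simp add: total_def card_PiE finI)

lemma total_sum: "total (\<lambda>x. \<Sum>m\<in>S. g m x) = (\<Sum>m\<in>S. total (g m))"
  unfolding total_def by (rule sum.swap)

text \<open>Summing the code equation over all words shows that the code has density \<gamma> / (2
  q).\<close>

lemma total_f: "2 * total f = \<gamma> * q ^ (card I - 1)" if "I \<noteq> {}"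
proof -
  have "int (card I) * (q * total f) = total (\<lambda>x. \<Sum>m\<in>I. line_sum A m f x)"
    by (simp add: total_sum total_line_sum)
  also have "\<dots> = (int (card I) - 2) * q * total f + \<gamma> * q ^ card I"
    by (simp add: lines total_def sum.distrib sum_distrib_left card_PiE finI)
  finally have "q * (2 * total f) = \<gamma> * q ^ card I" by (simp add: algebra_simps)
  also have "\<dots> = q * (\<gamma> * q ^ (card I - 1))"
    using that finI by (cases "card I") auto
  finally show ?thesis using q_pos by simp
qed

text \<open>Every layer has the density of the whole code. In the sum of the equation over one
  layer, the direction \<open>i\<close> contributes \<open>q * total f\<close>, which
  \<open>total_f\<close> evaluates.\<close>

lemma total_layer:
  assumes "i \<in> I"
  shows "2 * total (\<lambda>x. f (x(i := z))) = \<gamma> * q ^ (card I - 1)"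
proof -
  have "I \<noteq> {}" and n: "card I > 0" using assms finI card_gt_0_iff by auto
  have *: "line_sum A m f (x(i := z)) = line_sum A m (\<lambda>x. f (x(i := z))) x" if "m \<in> I - {i}" for m x
    using that by (simp add: line_sum_def fun_upd_twist)
  have "q * total f + (int (card I) - 1) * (q * total (\<lambda>x. f (x(i := z)))) =
      total (line_sum A i f) + (\<Sum>m\<in>I - {i}. total (line_sum A m (\<lambda>x. f (x(i := z)))))"
    using assms n by (simp add: total_line_sum of_nat_diff)
  also have "\<dots> = total (\<lambda>x. \<Sum>m\<in>I. line_sum A m f (x(i := z)))"
    using assms finI * by (simp add: total_def sum.distrib sum.remove[of I i] sum.swap[of _ "I - {i}"])
  also have "\<dots> = (int (card I) - 2) * q * total (\<lambda>x. f (x(i := z))) + \<gamma> * q ^ card I"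
    by (simp add: lines total_def sum.distrib sum_distrib_left card_PiE finI)
  finally have "q * (total f + total (\<lambda>x. f (x(i := z)))) = \<gamma> * q ^ card I" by (simp add: algebra_simps)
  also have "\<dots> = q * (\<gamma> * q ^ (card I - 1))"
    using n by (cases "card I") auto
  finally have "total f + total (\<lambda>x. f (x(i := z))) = \<gamma> * q ^ (card I - 1)" using q_pos by simp
  then show ?thesis using total_f[OF \<open>I \<noteq> {}\<close>] by linarith
qed

text \<open>The line sums in the two directions add up to \<gamma>. The first is independent of
  \<open>x i\<close>, the second of \<open>x j\<close>, so both are constant; their totals agree, so
  each is \<gamma> / 2.\<close>

lemma even_if_depends_on_two:
  assumes "i \<in> I" "j \<in> I" "i \<noteq> j" "depends_on {i, j} f"
  shows "even \<gamma>"
proof -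
  have sum: "line_sum A i f x + line_sum A j f x = \<gamma>" for x
    using lines_dep[OF _ assms(4), of x] assms by simp
  fix y :: "'i \<Rightarrow> 'a"
  have const: "line_sum A i f x = line_sum A i f y" for x
  proof -
    have "line_sum A i f x = line_sum A i f (x(i := y i))" by simp
    also have "\<dots> = \<gamma> - line_sum A j f (x(i := y i, j := y j))"
      using sum[of "x(i := y i)"] by simp
    also have "\<dots> = line_sum A i f (x(i := y i, j := y j))" using sum by (metis add_diff_cancel_right')
    also have "\<dots> = line_sum A i f y"
      unfolding line_sum_def by (intro sum.cong refl depends_onD[OF assms(4)]) auto
    finally show ?thesis .
  qed
  have "total (line_sum A i f) = total (line_sum A j f)" using assms by (simp add: total_line_sum)
  moreover have "line_sum A j f = (\<lambda>_. \<gamma> - line_sum A i f y)"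
    using sum const by (metis add_diff_cancel_left')
  moreover have "line_sum A i f = (\<lambda>_. line_sum A i f y)" using const by blast
  ultimately have "q ^ card I * line_sum A i f y = q ^ card I * (\<gamma> - line_sum A i f y)"
    by (metis total_const)
  then have "\<gamma> = 2 * line_sum A i f y" using q_pos by simp
  then show ?thesis by simp
qed

lemma layer_diff_range: "\<bar>layer_diff i z w x\<bar> \<le> 1"
  using range_f[of "x(i := z)"] range_f[of "x(i := w)"] by (auto simp: layer_diff_def)

lemma layer_diff_depends: "depends_on (I - {i}) (layer_diff i z w)"
  unfolding depends_on_def layer_diff_def
  by (intro allI impI arg_cong2[of _ _ _ _ "(-)"] depends_onD[OF depf]) auto

lemma layer_diff_retract: "\<exists>a'\<in>A. \<forall>x. layer_diff i z w (x(j := a)) = layer_diff i z w (x(j := a'))"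
proof (cases "i = j")
  case True
  then show ?thesis using retract[of a] by (auto simp: layer_diff_def)
next
  case False
  obtain a' where "a' \<in> A" "\<And>i x. f (x(i := a)) = f (x(i := a'))" using retract[of a] by blast
  moreover from this have "f (x(j := a, i := c)) = f (x(j := a', i := c))" for x c
    using False by (metis fun_upd_twist)
  ultimately show ?thesis by (auto simp: layer_diff_def)
qed

end

subsection \<open>Sparse codes\<close>

text \<open>Compares two densities: \<gamma> / (2 q) for the layer and
  \<open>card (A \<inter> X) / q\<close> for the half space. For odd \<gamma> this shape of a layer
  is therefore impossible.\<close>

lemma (in second_eigenvalue_code) gamma_if_layer_half_space:
  assumes "i \<in> I" "j \<in> I" "\<And>x. f (x(i := z)) = of_bool (x j \<in> X)"
  shows "\<gamma> = 2 * int (card (A \<inter> X))"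
proof -
  obtain n where n: "card I = Suc n" using assms(1) finI by (metis card_0_eq empty_iff not0_implies_Suc)
  have "line_sum A j (\<lambda>x. of_bool (x j \<in> X)) = (\<lambda>_. int (card (A \<inter> X)))"
    using finA by (simp add: line_sum_def fun_eq_iff)
  then have "q * total (\<lambda>x. of_bool (x j \<in> X)) = q ^ card I * int (card (A \<inter> X))"
    by (metis total_line_sum[OF assms(2)] total_const)
  then have "q * (2 * total (\<lambda>x. of_bool (x j \<in> X))) = q * (q ^ n * (2 * int (card (A \<inter> X))))"
    by (simp add: n algebra_simps)
  then have "2 * total (\<lambda>x. of_bool (x j \<in> X)) = q ^ n * (2 * int (card (A \<inter> X)))"
    using q_pos by simp
  then show ?thesis
    using total_layer[OF assms(1), of z] q_pos by (simp add: assms(3) n)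
qed

locale sparse_second_eigenvalue_code = second_eigenvalue_code A I f \<gamma>
  for A :: "'a set" and I :: "'i set" and f \<gamma> +
  assumes sparse: "2 * \<gamma> < int (card A)"
begin

text \<open>At the intersection of two such hyperplanes all line sums but one are maximal.\<close>
lemma hyperplane_unique:
  assumes "i \<in> I" "j \<in> I" "k \<in> I" "j \<noteq> i" "k \<noteq> i"
    and j: "\<And>x. x j = a \<Longrightarrow> f (x(i := z)) = 1"
    and k: "\<And>x. x k = b \<Longrightarrow> f (x(i := z)) = 1"
  shows "j = k"
proof (rule ccontr)
  assume "j \<noteq> k"
  define x where "x = (\<lambda>_. undefined)(i := z, j := a, k := b)"
  have x: "x i = z" "x j = a" "x k = b" using assms(4,5) \<open>j \<noteq> k\<close> by (auto simp: x_def)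
  \<comment> \<open>A change in one direction leaves the entry \<open>a\<close> at \<open>j\<close>
    or the entry \<open>b\<close> at \<open>k\<close> intact.\<close>
  have "line_sum A m f x \<ge> q" if "m \<in> I - {i}" for m
  proof (rule line_ge_card)
    fix c
    have "(x(m := c))(i := z) = x(m := c)" using that x by auto
    then show "f (x(m := c)) = 1"
      using j[of "x(m := c)"] k[of "x(m := c)"] x \<open>j \<noteq> k\<close> by (cases "m = j") auto
  qed simp
  then have "(\<Sum>m\<in>I - {i}. line_sum A m f x) \<ge> int (card (I - {i})) * q"
    using sum_bounded_below[of "I - {i}" q "\<lambda>m. line_sum A m f x"] by simp
  moreover have "int (card (I - {i})) = int (card I) - 1"
    using finI assms(1) card_Suc_Diff1[of I i] by simp
  moreover have "f x = 1" using j[of x] x by (metis fun_upd_triv)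
  \<comment> \<open>The equation at the codeword \<open>x\<close> gives
    \<open>(card I - 1) * q \<le> (card I - 2) * q + \<gamma>\<close>.\<close>
  ultimately have "\<gamma> \<ge> q"
    using lines[of x] line_nonneg[of i x] finI assms(1) by (simp add: sum.remove[of I i] algebra_simps)
  then show False using sparse q_pos by simp
qed

text \<open>
  If both of the blocks on which the two layers agree had a zero of \<open>f\<close>, then the equation for
  the line sums at the two zeros would give \<open>\<gamma> \<ge> q - card (A \<inter> Y)\<close> and \<open>\<gamma> \<ge> card (A \<inter> X)\<close>,
  which contradicts sparseness as both cards are equal.
\<close>
lemma half_spaces_full:
  assumes ijk: "i \<in> I" "j \<in> I" "k \<in> I" "i \<noteq> j" "i \<noteq> k" "j \<noteq> k"
    and d: "\<And>x. layer_diff i z w x = of_bool (x j \<in> X) - of_bool (x k \<in> Y)"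
    and ne: "X \<noteq> {}" "X \<noteq> UNIV" "Y \<noteq> {}" "Y \<noteq> UNIV"
  shows "(\<forall>x. x j \<in> X \<and> x k \<in> Y \<longrightarrow> f (x(i := z)) = 1) \<or>
    (\<forall>x. x j \<notin> X \<and> x k \<notin> Y \<longrightarrow> f (x(i := z)) = 1)"
proof (rule ccontr)
  assume "\<not> ?thesis"
  then obtain x y where x: "x j \<in> X" "x k \<in> Y" "f (x(i := z)) \<noteq> 1"
    and y: "y j \<notin> X" "y k \<notin> Y" "f (y(i := z)) \<noteq> 1" by blast
  have one: "f (v(i := z)) = 1" if "v j \<in> X" "v k \<notin> Y" for v
    using d[of v] that range_f[of "v(i := z)"] range_f[of "v(i := w)"] by (auto simp: layer_diff_def)
  \<comment> \<open>Outside the code the line sums add up to \<gamma> and are nonnegative, so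
    \<gamma> bounds each of them.\<close>
  have \<gamma>: "\<gamma> \<ge> line_sum A m f v" if "f v \<noteq> 1" "m \<in> I" for m v
    using lines[of v] range_f[of v] that member_le_sum[OF that(2), of "\<lambda>m. line_sum A m f v"] finI line_nonneg
    by fastforce
  have "line_sum A k f (x(i := z)) \<ge> int (card (A - Y))"
  proof (rule line_ge_card)
    fix a assume "a \<in> A - Y"
    then show "f (x(i := z, k := a)) = 1"
      using one[of "x(k := a)"] x ijk by (simp add: fun_upd_twist)
  qed simp
  then have "\<gamma> \<ge> int (card (A - Y))" using \<gamma>[OF x(3) ijk(3)] by linarith
  moreover have "line_sum A j f (y(i := z)) \<ge> int (card (A \<inter> X))"
  proof (rule line_ge_card)
    fix a assume "a \<in> A \<inter> X"
    then show "f (y(i := z, j := a)) = 1"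
      using one[of "y(j := a)"] y ijk by (simp add: fun_upd_twist)
  qed simp
  then have "\<gamma> \<ge> int (card (A \<inter> X))" using \<gamma>[OF y(3) ijk(2)] by linarith
  moreover have "card (A \<inter> X) = card (A \<inter> Y)"
  proof -
    \<comment> \<open>At a point where the difference is 1, the two line sums are
      \<open>card (A \<inter> X)\<close> and \<open>q - card (A \<inter> Y)\<close>, and they add up
      to \<open>q\<close>.\<close>
    obtain a b where ab: "a \<in> X" "b \<notin> Y" using ne by blast
    define v where "v = (\<lambda>_. undefined)(j := a, k := b)"
    have v: "v j = a" "v k = b" using ijk by (auto simp: v_def)
    have "depends_on {j, k} (layer_diff i z w)" by (auto simp: depends_on_def d)
    then have "line_sum A j (layer_diff i z w) v + line_sum A k (layer_diff i z w) v = q"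
      using layer_diff_lines_dep[of i "{j, k}" z w v] ijk ab v by (simp add: d)
    moreover have "line_sum A j (layer_diff i z w) v = int (card (A \<inter> X))"
      using ijk ab v finA by (simp add: line_sum_def d)
    moreover have "line_sum A k (layer_diff i z w) v = q - int (card (A \<inter> Y))"
      using ijk ab v finA by (simp add: line_sum_def d sum_subtractf)
    ultimately show ?thesis by simp
  qed
  moreover have "int (card (A - Y)) = q - int (card (A \<inter> Y))"
    using finA by (simp add: card_Diff_subset_Int of_nat_diff card_mono)
  ultimately show False using sparse by linarith
qed

text \<open>By vanishing third differences \<open>separable_cases\<close> applies. The line sum
  equation excludes nonzero constants and one-signed functions of one coordinate, and
  \<open>half_spaces_full\<close> yields the hyperplanes in the last case.\<close>

lemma layer_cases:
  assumes i: "i \<in> I"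
  obtains (same) "\<And>x. f (x(i := z)) = f (x(i := w))"
    | (one) j u a b where "j \<in> I" "j \<noteq> i" "\<And>x. f (x(i := z)) - f (x(i := w)) = u (x j)"
        "u a = 1" "u b = (-1::int)"
    | (two) j k X Y where "j \<in> I" "k \<in> I" "j \<noteq> i" "k \<noteq> i" "j \<noteq> k" "X \<noteq> {}" "Y \<noteq> {}" "Y \<noteq> UNIV"
        "\<And>x. f (x(i := z)) - f (x(i := w)) = of_bool (x j \<in> X) - of_bool (x k \<in> Y)"
        "\<And>x. x j \<in> X \<Longrightarrow> f (x(i := z)) = 1"
        "\<And>x. x k \<in> Y \<Longrightarrow> f (x(i := w)) = 1"
proof -
  let ?d = "layer_diff i z w"
  have fin: "finite (I - {i})" using finI by simp
  have mixed: "?d (x(j := b, k := c)) = ?d (x(j := b)) + ?d (x(k := c)) - ?d x"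
    if "j \<in> I - {i}" "k \<in> I - {i}" "j \<noteq> k" for j k x b c
    using that i by (intro layer_diff_mixed) auto
  consider (const) "depends_on {} ?d"
    | (one) j where "j \<in> I - {i}" "depends_on {j} ?d"
    | (two) j k X Y where "j \<in> I - {i}" "k \<in> I - {i}" "j \<noteq> k"
        "\<And>x. ?d x = of_bool (x j \<in> X) - of_bool (x k \<in> Y)"
        "X \<noteq> {}" "X \<noteq> UNIV" "Y \<noteq> {}" "Y \<noteq> UNIV"
    by (rule separable_cases[OF fin layer_diff_depends layer_diff_range mixed]) blast+
  then show thesis
  proof cases
    case const
    \<comment> \<open>For the empty set of directions the equation reads
      \<open>0 = - q * ?d x\<close>.\<close>
    have "?d x = 0" for x
      using layer_diff_lines_dep[OF i _ const, of x] q_pos by simp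
    then show ?thesis using same by (simp add: layer_diff_def)
  next
    case (one j)
    note dep = this
    define u where "u a = ?d (\<lambda>_. a)" for a
    have u: "?d x = u (x j)" for x unfolding u_def by (rule depends_onD[OF dep(2)]) simp
    \<comment> \<open>For one direction the factor is 0, so a nonzero \<open>u\<close> takes both
      signs.\<close>
    have sum0: "(\<Sum>a\<in>A. u a) = 0"
      using layer_diff_lines_dep[OF i _ dep(2), of undefined] dep(1) by (simp add: line_sum_def u)
    have bnd: "\<bar>u a\<bar> \<le> 1" for a unfolding u_def by (rule layer_diff_range)
    show ?thesis
    proof (cases "\<exists>x. ?d x \<noteq> 0")
      case False
      then show ?thesis using same by (simp add: layer_diff_def)
    next
      case True
      then obtain x where "?d x \<noteq> 0" by blast
      moreover obtain a where a: "a \<in> A" "?d (x(j := x j)) = ?d (x(j := a))"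
        using layer_diff_retract[of i z w j "x j"] by blast
      ultimately have "u a \<noteq> 0" using u[of "x(j := a)"] by simp
      have "\<exists>b. u b = 1"
      proof (rule ccontr)
        assume "\<not> ?thesis"
        then have "u b \<le> 0" for b using bnd[of b] by (smt (verit))
        then have "\<forall>b\<in>A. - u b = 0"
          using sum_nonneg_eq_0_iff[OF finA, of "\<lambda>b. - u b"] sum0 by (simp add: sum_negf)
        then show False using \<open>u a \<noteq> 0\<close> a by simp
      qed
      moreover have "\<exists>b. u b = -1"
      proof (rule ccontr)
        assume "\<not> ?thesis"
        then have "u b \<ge> 0" for b using bnd[of b] by (smt (verit))
        then have "\<forall>b\<in>A. u b = 0"
          using sum_nonneg_eq_0_iff[OF finA, of u] sum0 by simp
        then show False using \<open>u a \<noteq> 0\<close> a by simp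
      qed
      ultimately show ?thesis using that(2)[of j u] dep(1) u by (auto simp: layer_diff_def)
    qed
  next
    case (two j k X Y)
    have d: "f (x(i := z)) - f (x(i := w)) = of_bool (x j \<in> X) - of_bool (x k \<in> Y)" for x
      using two(4) by (simp add: layer_diff_def)
    have f1: "f x \<le> 1" for x using range_f[of x] by auto
    have ijk: "j \<in> I" "k \<in> I" "i \<noteq> j" "i \<noteq> k" using two by auto
    consider "\<forall>x. x j \<in> X \<and> x k \<in> Y \<longrightarrow> f (x(i := z)) = 1" |
      "\<forall>x. x j \<notin> X \<and> x k \<notin> Y \<longrightarrow> f (x(i := z)) = 1"
      using half_spaces_full[OF i ijk two(3-8)] by blast
    then show ?thesis
    proof cases
      case 1
      have "f (x(i := z)) = 1" if "x j \<in> X" for x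
        using 1 d[of x] that range_f[of "x(i := z)"] range_f[of "x(i := w)"] by (cases "x k \<in> Y") auto
      moreover have "f (x(i := w)) = 1" if "x k \<in> Y" for x
        using 1 d[of x] that range_f[of "x(i := z)"] range_f[of "x(i := w)"] by (cases "x j \<in> X") auto
      ultimately show ?thesis using that(3)[of j k X Y] two ijk d by auto
    next
      case 2
      \<comment> \<open>Passing to complements leaves the difference unchanged but exchanges the
        roles of \<open>j\<close> and \<open>k\<close>.\<close>
      have "f (x(i := z)) = 1" if "x k \<in> - Y" for x
        using 2 d[of x] that range_f[of "x(i := z)"] range_f[of "x(i := w)"] by (cases "x j \<in> X") auto
      moreover have "f (x(i := w)) = 1" if "x j \<in> - X" for x
        using 2 d[of x] that range_f[of "x(i := z)"] range_f[of "x(i := w)"] by (cases "x k \<in> Y") auto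
      moreover have "f (x(i := z)) - f (x(i := w)) = of_bool (x k \<in> - Y) - of_bool (x j \<in> - X)" for x
        using d[of x] by auto
      moreover have "- Y \<noteq> {}" "- X \<noteq> {}" "- X \<noteq> UNIV" using two(5-8) by auto
      ultimately show ?thesis using that(3)[of k j "- Y" "- X"] two ijk by auto
    qed
  qed
qed

end

section \<open>Counting lines in three directions\<close>

text \<open>The code is a disjoint union of lines, encoded by three bipartite graphs:
  \<open>Z\<close> with \<open>X\<close>, \<open>A - Z\<close> with \<open>Y\<close>, and
  \<open>A - X\<close> with \<open>A - Y\<close>. The code equation makes them biregular with
  degrees \<open>a\<close>, \<open>b\<close>, \<open>c0\<close>; counting edges gives the equations
  of Condition 1, and degrees are at most the sizes of the parts.\<close>

lemma condition1_if_three_coordinates: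
  fixes A Z :: "'a set" and R :: "'a \<Rightarrow> 'a set" and G :: "'a \<Rightarrow> 'a \<Rightarrow> bool" and \<gamma> :: int
  defines "F \<equiv> \<lambda>v x y. of_bool (if v \<in> Z then x \<in> R v else y \<in> R v) + of_bool (G x y) :: int"
  assumes fin: "finite A"
    and lines: "\<And>v x y. (\<Sum>v'\<in>A. F v' x y) + (\<Sum>x'\<in>A. F v x' y) + (\<Sum>y'\<in>A. F v x y')
      = int (card A) * F v x y + \<gamma>"
    and disj1: "\<And>v x y. v \<in> Z \<Longrightarrow> x \<in> R v \<Longrightarrow> \<not> G x y"
    and disj2: "\<And>v x y. v \<notin> Z \<Longrightarrow> y \<in> R v \<Longrightarrow> \<not> G x y"
    and z: "z \<in> A" "z \<in> Z" "xz \<in> A" "xz \<in> R z"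
    and w: "w \<in> A" "w \<notin> Z" "yw \<in> A" "yw \<in> R w"
    and odd: "odd \<gamma>"
  shows "condition1 (int (card A)) \<gamma>"
proof -
  define \<rho> where "\<rho> x = card {v \<in> A \<inter> Z. x \<in> R v}" for x
  define \<kappa> where "\<kappa> y = card {v \<in> A - Z. y \<in> R v}" for y
  define Gr where "Gr x = card {y \<in> A. G x y}" for x
  define Gc where "Gc y = card {x \<in> A. G x y}" for y
  define c where "c v = card (A \<inter> R v)" for v
  have card_q: "A \<inter> Collect P = {a \<in> A. P a}" for P by auto
  have s1: "(\<Sum>v'\<in>A. F v' x y) = int (\<rho> x) + int (\<kappa> y) + int (card A) * of_bool (G x y)" for x y
  proof -
    have "{v \<in> A. if v \<in> Z then x \<in> R v else y \<in> R v} = {v \<in> A \<inter> Z. x \<in> R v} \<union> {v \<in> A - Z. y \<in> R v}"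
      by auto
    then have "card {v \<in> A. if v \<in> Z then x \<in> R v else y \<in> R v} = \<rho> x + \<kappa> y"
      unfolding \<rho>_def \<kappa>_def using fin by (simp only:) (subst card_Un_disjoint; auto)
    then show ?thesis using fin by (simp add: F_def sum.distrib card_q)
  qed
  have s2: "(\<Sum>x'\<in>A. F v x' y) =
      (if v \<in> Z then int (c v) else int (card A) * of_bool (y \<in> R v)) + int (Gc y)" for v y
    using fin by (simp add: F_def sum.distrib Gc_def c_def card_q Int_def)
  have s3: "(\<Sum>y'\<in>A. F v x y') =
      (if v \<in> Z then int (card A) * of_bool (x \<in> R v) else int (c v)) + int (Gr x)" for v x
    using fin by (simp add: F_def sum.distrib Gr_def c_def card_q Int_def)
  \<comment> \<open>All multiples of \<open>card A\<close> cancel. What remains is a sum of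
    functions of \<open>x\<close>, of \<open>y\<close> and of \<open>v\<close>, so each of the three
    is constant.\<close>
  have main: "int (\<rho> x + Gr x) + int (\<kappa> y + Gc y) + int (c v) = \<gamma>" for v x y
    using lines[of x y v] unfolding s1 s2 s3 by (cases "v \<in> Z") (simp_all add: F_def algebra_simps)
  define a b c0 where "a = \<rho> xz + Gr xz" and "b = \<kappa> yw + Gc yw" and "c0 = c z"
  have a: "\<rho> x + Gr x = a" for x using main[of x yw z] main[of xz yw z] by (simp add: a_def)
  have b: "\<kappa> y + Gc y = b" for y using main[of xz y z] main[of xz yw z] by (simp add: b_def)
  have c: "c v = c0" for v using main[of xz yw z] main[of xz yw v] by (simp add: c0_def)
  have \<gamma>: "\<gamma> = int a + int b + int c0" using main[of xz yw z] by (simp add: a_def b_def c0_def)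
  \<comment> \<open>These are the entries that occur in some \<open>R v\<close>. By disjointness
    from \<open>G\<close>, the sum \<open>\<rho> x + Gr x\<close> is \<open>\<rho> x\<close> on
    \<open>X\<close> and \<open>Gr x\<close> on the rest of \<open>A\<close>; likewise for
    \<open>Y\<close>.\<close>
  define X where "X = {x \<in> A. \<exists>v \<in> A \<inter> Z. x \<in> R v}"
  define Y where "Y = {y \<in> A. \<exists>v \<in> A - Z. y \<in> R v}"
  have finXY: "finite X" "finite Y" "X \<subseteq> A" "Y \<subseteq> A" using fin by (auto simp: X_def Y_def)
  have X1: "\<rho> x = a" if "x \<in> X" for x
  proof -
    have "Gr x = 0" using that disj1 fin by (auto simp: X_def Gr_def)
    then show ?thesis using a[of x] by simp
  qed
  have X2: "Gr x = a" if "x \<in> A - X" for x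
  proof -
    have "\<rho> x = 0" using that fin by (auto simp: X_def \<rho>_def)
    then show ?thesis using a[of x] by simp
  qed
  have Y1: "\<kappa> y = b" if "y \<in> Y" for y
  proof -
    have "Gc y = 0" using that disj2 fin by (auto simp: Y_def Gc_def)
    then show ?thesis using b[of y] by simp
  qed
  have Y2: "Gc y = b" if "y \<in> A - Y" for y
  proof -
    have "\<kappa> y = 0" using that fin by (auto simp: Y_def \<kappa>_def)
    then show ?thesis using b[of y] by simp
  qed
  have GXY: "x \<in> A - X \<and> y \<in> A - Y" if "G x y" "x \<in> A" "y \<in> A" for x y
    using that disj1 disj2 by (auto simp: X_def Y_def)
  have "(\<Sum>v\<in>A \<inter> Z. card {x \<in> X. x \<in> R v}) = a * card X"
    using fin finXY X1 by (intro sum_multicount) (auto simp: \<rho>_def)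
  moreover have "card {x \<in> X. x \<in> R v} = c0" if "v \<in> A \<inter> Z" for v
    using that c[of v] by (auto simp: c_def X_def intro!: arg_cong[of _ _ card])
  ultimately have e1: "card (A \<inter> Z) * c0 = a * card X" by simp
  have "(\<Sum>v\<in>A - Z. card {y \<in> Y. y \<in> R v}) = b * card Y"
    using fin finXY Y1 by (intro sum_multicount) (auto simp: \<kappa>_def)
  moreover have "card {y \<in> Y. y \<in> R v} = c0" if "v \<in> A - Z" for v
    using that c[of v] by (auto simp: c_def Y_def intro!: arg_cong[of _ _ card])
  ultimately have e2: "card (A - Z) * c0 = b * card Y" by simp
  have Gr': "card {y \<in> A - Y. G x y} = a" if "x \<in> A - X" for x
    using X2[OF that] GXY that by (auto simp: Gr_def intro!: arg_cong[of _ _ card])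
  have Gc': "card {x \<in> A - X. G x y} = b" if "y \<in> A - Y" for y
    using Y2[OF that] GXY that by (auto simp: Gc_def intro!: arg_cong[of _ _ card])
  have "(\<Sum>x\<in>A - X. card {y \<in> A - Y. G x y}) = b * card (A - Y)"
    using fin Gc' by (intro sum_multicount) auto
  then have e3: "card (A - X) * a = b * card (A - Y)" using Gr' by simp
  have xzX: "xz \<in> X" and ywY: "yw \<in> Y" using z w by (auto simp: X_def Y_def)
  have a_le: "a \<le> card (A \<inter> Z)"
    using X1[OF xzX] fin by (auto simp: \<rho>_def intro!: card_mono)
  have b_le: "b \<le> card (A - Z)"
    using Y1[OF ywY] fin by (auto simp: \<kappa>_def intro!: card_mono)
  have "c z \<le> card X" unfolding c_def using finXY z by (intro card_mono) (auto simp: X_def)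
  moreover have "c w \<le> card Y" unfolding c_def using finXY w by (intro card_mono) (auto simp: Y_def)
  ultimately have c_le: "c0 \<le> card X" "c0 \<le> card Y" using c by auto
  have "a > 0"
    using X1[OF xzX] z fin by (auto simp: \<rho>_def card_gt_0_iff)
  have "b > 0"
    using Y1[OF ywY] w fin by (auto simp: \<kappa>_def card_gt_0_iff)
  have "c0 > 0" using z fin unfolding c0_def c_def by (auto simp: card_gt_0_iff)
  have cards: "card (A - X) + card X = card A" "card (A - Y) + card Y = card A"
    "card (A - Z) + card (A \<inter> Z) = card A"
    using fin finXY by (simp_all add: card_Diff_subset card_mono card_Diff_subset_Int)
  \<comment> \<open>By \<open>e3\<close> both complements would be empty; then \<open>e1\<close> and
    \<open>e2\<close> add up to \<open>c0 = a + b\<close>, which makes \<gamma> even.\<close>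
  have ne: "card (A - X) > 0 \<and> card (A - Y) > 0"
  proof (rule ccontr)
    assume "\<not> ?thesis"
    then have "card (A - X) = 0 \<and> card (A - Y) = 0" using e3 \<open>a > 0\<close> \<open>b > 0\<close> by auto
    then have "card X = card A" "card Y = card A" using cards by auto
    then have "card A * c0 = card A * (a + b)"
      using e1 e2 cards(3) by (metis add_mult_distrib add_mult_distrib2 add.commute mult.commute)
    then have "c0 = a + b" using z fin by auto
    then have "even \<gamma>" using \<gamma> by simp
    then show False using odd by simp
  qed
  have a_le2: "a \<le> card (A - Y)"
  proof -
    obtain x where "x \<in> A - X" using ne by (metis card.empty ex_in_conv less_irrefl)
    from Gr'[OF this] show ?thesis using fin by (auto intro!: card_mono)
  qed
  have b_le2: "b \<le> card (A - X)"
  proof -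
    obtain y where "y \<in> A - Y" using ne by (metis card.empty ex_in_conv less_irrefl)
    from Gc'[OF this] show ?thesis using fin by (auto intro!: card_mono)
  qed
  let ?q = "int (card A)"
  have int_cards: "?q - int (card (A - X)) = int (card X)" "?q - int (card (A - Y)) = int (card Y)"
    "?q - int (card (A \<inter> Z)) = int (card (A - Z))" using cards by linarith+
  have pos: "card X > 0" "card Y > 0" "card (A \<inter> Z) > 0" "card (A - Z) > 0"
    using c_le \<open>c0 > 0\<close> a_le b_le \<open>a > 0\<close> \<open>b > 0\<close> by auto
  \<comment> \<open>The witnesses for \<open>r\<close>, \<open>s\<close>, \<open>t\<close> are the
    sizes of \<open>A \<inter> Z\<close>, \<open>A - Y\<close> and \<open>A - X\<close>.\<close>
  show ?thesis
    unfolding condition1_def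
    apply (rule exI[of _ "int (card (A \<inter> Z))"], rule exI[of _ "int (card (A - Y))"],
        rule exI[of _ "int (card (A - X))"], rule exI[of _ "int a"], rule exI[of _ "int b"],
        rule exI[of _ "int c0"])
    unfolding int_cards
    using pos ne cards \<gamma> \<open>a > 0\<close> \<open>b > 0\<close> \<open>c0 > 0\<close> a_le a_le2 b_le b_le2 c_le e1 e2 e3
    by (simp flip: of_nat_mult add: mult.commute)
qed

section \<open>Reduction of sparse codes to three coordinates\<close>

context sparse_second_eigenvalue_code
begin

text \<open>Otherwise some layer contains a full hyperplane \<open>x i = z\<close>,
  \<open>x j = a\<close>. By \<open>hyperplane_unique\<close> the differences to that layer involve
  \<open>x j\<close> only, and after exchanging \<open>i\<close> and \<open>j\<close> those to layer
  \<open>a\<close> of direction \<open>j\<close> involve \<open>x i\<close> only.\<close>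

lemma exists_two_directions:
  assumes "odd \<gamma>"
  obtains i j k z w X Y where "i \<in> I" "j \<in> I" "k \<in> I" "j \<noteq> i" "k \<noteq> i" "j \<noteq> k"
    "X \<noteq> {}" "Y \<noteq> {}" "Y \<noteq> UNIV"
    "\<And>x. f (x(i := z)) - f (x(i := w)) = of_bool (x j \<in> X) - of_bool (x k \<in> Y)"
    "\<And>x. x j \<in> X \<Longrightarrow> f (x(i := z)) = 1"
    "\<And>x. x k \<in> Y \<Longrightarrow> f (x(i := w)) = 1"
proof (rule ccontr)
  assume "\<not> thesis"
  note no_two = that[THEN notE[OF this]]
  have cases: thesis if "i \<in> I"
    "(\<And>x. f (x(i := z)) = f (x(i := w))) \<Longrightarrow> thesis"
    "\<And>j u a b. j \<in> I \<Longrightarrow> j \<noteq> i \<Longrightarrow> (\<And>x. f (x(i := z)) - f (x(i := w)) = u (x j)) \<Longrightarrow>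
      u a = 1 \<Longrightarrow> u b = (-1::int) \<Longrightarrow> thesis" for thesis i z w
    by (rule layer_cases[OF that(1), of z w]) (use that no_two that(1) in \<open>blast+\<close>)
  have upd1: "f (x(i := z)) = 1 \<and> f (x(i := w)) = 0" if "f (x(i := z)) - f (x(i := w)) = 1" for x i z w
    using that range_f[of "x(i := z)"] range_f[of "x(i := w)"] by auto
  have direction: "\<exists>u. \<forall>x. f (x(i := z)) - f (x(i := v)) = u (x j)"
    if h: "i \<in> I" "j \<in> I" "j \<noteq> i" "\<And>x. x j = a \<Longrightarrow> f (x(i := z)) = 1" for i j z v a
  proof (rule cases[OF h(1), of z v])
    assume "\<And>x. f (x(i := z)) = f (x(i := v))"
    then show ?thesis by (intro exI[of _ "\<lambda>_. 0"]) simp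
  next
    fix j' u a' b assume *: "j' \<in> I" "j' \<noteq> i" "\<And>x. f (x(i := z)) - f (x(i := v)) = u (x j')" "u a' = 1"
    have fz: "f (x(i := z)) = 1" if "x j' = a'" for x
      using *(3)[of x] *(4) that upd1[of x i z v] by simp
    have "j = j'"
      by (rule hyperplane_unique[OF h(1,2) *(1) h(3) *(2) h(4) fz])
    then show ?thesis using * by blast
  qed
  \<comment> \<open>For constant \<open>f\<close> the code equation without any direction says
    \<open>2 * q * f x = \<gamma>\<close>.\<close>
  have "\<exists>i\<in>I. \<exists>x z w. f (x(i := z)) \<noteq> f (x(i := w))"
  proof (rule ccontr)
    assume "\<not> ?thesis"
    then have "f (x(i := a)) = f x" if "i \<in> I" for i x a using that by (metis fun_upd_triv)
    then have "depends_on {} f" by (intro depends_on_shrink[OF finI depf]) auto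
    then have "2 * q * f x = \<gamma>" for x using lines_dep[of "{}" x] by simp
    then show False using assms by (metis dvd_triv_left mult.assoc)
  qed
  then obtain i x0 z w where i: "i \<in> I" and neq: "f (x0(i := z)) \<noteq> f (x0(i := w))" by blast
  obtain j u a b where j: "j \<in> I" "j \<noteq> i" and u: "\<And>x. f (x(i := z)) - f (x(i := w)) = u (x j)"
    and ab: "u a = 1" "u b = (-1::int)"
    by (rule cases[OF i, of z w]) (use neq in blast)+
  have a: "f (x(i := z)) = 1" "f (x(i := w)) = 0" if "x j = a" for x
    using u[of x] ab that upd1 by metis+
  have b: "f (x(i := w)) = 1" "f (x(i := z)) = 0" if "x j = b" for x
    using u[of x] ab that upd1[where x=x and z=w and w=z and i=i] by (smt (verit))+
  have dir_i: "\<exists>u. \<forall>x. f (x(i := z)) - f (x(i := v)) = u (x j)" for v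
    by (rule direction[OF i j a(1)])
  \<comment> \<open>The same hyperplane, now seen inside layer \<open>a\<close> of direction
    \<open>j\<close>.\<close>
  have fz: "f (x(j := a)) = 1" if "x i = z" for x
    using a(1)[of "x(j := a)"] that j by (metis fun_upd_same fun_upd_triv fun_upd_twist)
  have dir_j: "\<exists>u. \<forall>x. f (x(j := a)) - f (x(j := v)) = u (x i)" for v
    by (rule direction[OF j(1) i j(2)[symmetric] fz])
  \<comment> \<open>Move \<open>x\<close> to entry \<open>z\<close> at \<open>i\<close> and then to
    entry \<open>a\<close> at \<open>j\<close>, where \<open>f\<close> is 1. Neither increment
    depends on the entry at \<open>m\<close>.\<close>
  have "f (x(m := c)) = f x" if m: "m \<in> I - {i, j}" for m x c
  proof -
    obtain u1 where "\<And>y. f (y(i := z)) - f (y(i := x i)) = u1 (y j)" using dir_i by blast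
    from this[of x] this[of "x(m := c)"]
    have 1: "f (x(m := c)) - f x = f (x(i := z, m := c)) - f (x(i := z))"
      using m by (auto simp: fun_upd_twist fun_upd_idem)
    obtain u2 where u2: "\<And>y. f (y(j := a)) - f (y(j := x j)) = u2 (y i)" using dir_j by blast
    have e: "(x(i := z))(j := x j) = x(i := z)" "(x(i := z, m := c))(j := x j) = x(i := z, m := c)"
      using m j by (auto simp: fun_eq_iff)
    have "f (x(i := z, j := a)) - f (x(i := z)) = u2 z"
      using u2[of "x(i := z)"] unfolding e by simp
    moreover have "f (x(i := z, m := c, j := a)) - f (x(i := z, m := c)) = u2 z"
      using u2[of "x(i := z, m := c)"] m unfolding e by auto
    ultimately have "f (x(i := z, j := a)) - f (x(i := z)) = f (x(i := z, m := c, j := a)) - f (x(i := z, m := c))"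
      by simp
    then show ?thesis using 1 fz[of "x(i := z)"] fz[of "x(i := z, m := c)"] m by auto
  qed
  then have "depends_on {i, j} f" by (intro depends_on_shrink[OF finI depf]) auto
  then show False using even_if_depends_on_two[OF i j(1)] j(2) assms by auto
qed

end

context sparse_second_eigenvalue_code
begin

text \<open>In the third difference in directions \<open>j\<close>, \<open>k\<close>,
  \<open>m\<close> the indicator of \<open>X\<close> cancels, and the values of \<open>g\<close> at
  entry \<open>a\<close> or \<open>b\<close> vanish. Only \<open>g x - g (x(m := c))\<close> is
  left.\<close>

lemma remainder_insensitive:
  assumes I: "i \<in> I" "j \<in> I" "k \<in> I" "m \<in> I" and ne: "j \<noteq> i" "k \<noteq> i" "m \<noteq> i" "j \<noteq> k" "m \<noteq> j" "m \<noteq> k"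
    and f: "\<And>x. f (x(i := z)) = of_bool (x j \<in> X) + g x"
    and gX: "\<And>x. x j \<in> X \<Longrightarrow> g x = 0" and gY: "\<And>x. x k \<in> Y \<Longrightarrow> g x = 0"
    and "a \<in> X" "b \<in> Y"
  shows "g (x(m := c)) = g x"
proof -
  have "diff_op m c (diff_op k b (diff_op j a f)) (x(i := z)) = 0"
    by (rule mixed3) (use I ne in auto)
  moreover have "x(i := z, n := e) = x(n := e, i := z)" if "n \<noteq> i" for n e and x :: "'i \<Rightarrow> 'a"
    using that by (auto simp: fun_eq_iff)
  ultimately show ?thesis
    using ne \<open>a \<in> X\<close> \<open>b \<in> Y\<close> by (simp add: diff_op_def f gX gY)
qed

lemma condition1_if_odd:
  assumes "odd \<gamma>"
  shows "condition1 q \<gamma>"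
proof -
  obtain i j k z w X Y where I: "i \<in> I" "j \<in> I" "k \<in> I" and ne: "j \<noteq> i" "k \<noteq> i" "j \<noteq> k"
    and XY: "X \<noteq> {}" "Y \<noteq> {}" "Y \<noteq> UNIV"
    and d: "\<And>x. f (x(i := z)) - f (x(i := w)) = of_bool (x j \<in> X) - of_bool (x k \<in> Y)"
    and fX: "\<And>x. x j \<in> X \<Longrightarrow> f (x(i := z)) = 1"
    and fY: "\<And>x. x k \<in> Y \<Longrightarrow> f (x(i := w)) = 1"
    using exists_two_directions[OF assms] by metis
  obtain a0 b0 where a0: "a0 \<in> X" and b0: "b0 \<in> Y" using XY by blast
  have fa0: "f (x(i := z)) = 1" if "x j = a0" for x using fX[of x] that a0 by simp
  \<comment> \<open>The part of layer \<open>z\<close> outside its full hyperplanes; by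
    \<open>d\<close> it is also the part of layer \<open>w\<close> outside those of direction
    \<open>k\<close>.\<close>
  define g where "g x = f (x(i := z)) - of_bool (x j \<in> X)" for x
  have gz: "f (x(i := z)) = of_bool (x j \<in> X) + g x" for x by (simp add: g_def)
  have gw: "f (x(i := w)) = of_bool (x k \<in> Y) + g x" for x using d[of x] by (simp add: g_def)
  have gX: "g x = 0" if "x j \<in> X" for x using fX[of x] that by (simp add: g_def)
  have gY: "g x = 0" if "x k \<in> Y" for x using fY[of x] gw[of x] that by simp
  have g01: "g x = 0 \<or> g x = 1" for x using gX[of x] gz[of x] range_f[of "x(i := z)"] by (cases "x j \<in> X") auto
  have g_upd: "g (x(m := c)) = g x" if "m \<in> I - {j, k}" for m x c
  proof (cases "m = i")
    case True
    then show ?thesis using ne by (simp add: g_def)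
  next
    case False
    then show ?thesis
      using that I ne a0 b0 by (intro remainder_insensitive[OF I(1-3) _ _ _ _ _ _ _ gz gX gY, where a = a0 and b = b0]) auto
  qed
  have depg: "depends_on I g"
    unfolding depends_on_def g_def using I(2)
    by (intro allI impI arg_cong2[of _ _ _ _ "(-)"] depends_onD[OF depf]) auto
  have dep: "depends_on {j, k} g"
    by (rule depends_on_shrink[OF finI depg]) (use g_upd in auto)
  obtain y where y: "g y = 1"
  proof (rule ccontr)
    assume "\<not> thesis"
    then have "f (x(i := z)) = of_bool (x j \<in> X)" for x using that g01[of x] by (auto simp: g_def)
    from gamma_if_layer_half_space[OF I(1,2) this] assms show False by simp
  qed
  have layer: "\<exists>m\<in>{j, k}. \<exists>R. R \<noteq> {} \<and> (\<forall>x. f (x(i := v)) = of_bool (x m \<in> R) + g x)" for v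
  proof (rule layer_cases[OF I(1), of z v])
    assume "\<And>x. f (x(i := z)) = f (x(i := v))"
    then have "f (x(i := v)) = of_bool (x j \<in> X) + g x" for x using gz[of x] by simp
    then show ?thesis using a0 by blast
  next
    fix j' u a b assume *: "j' \<in> I" "j' \<noteq> i" "\<And>x. f (x(i := z)) - f (x(i := v)) = u (x j')"
      and u: "u a = 1" "u b = (-1::int)"
    have fa: "f (x(i := z)) = 1" if "x j' = a" for x
      using *(3)[of x] u that range_f[of "x(i := z)"] range_f[of "x(i := v)"] by auto
    have "j = j'"
      by (rule hyperplane_unique[OF I(1,2) *(1) ne(1) *(2) fa0 fa])
    note u_eq = *(3)[folded this]
    \<comment> \<open>With entry \<open>b0\<close> at \<open>k\<close> the remainder vanishes, so
      the expression is a value of \<open>f\<close> in layer \<open>v\<close>.\<close>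
    have u01: "of_bool (c \<in> X) - u c = 0 \<or> of_bool (c \<in> X) - u c = 1" for c
    proof -
      define x where "x = (\<lambda>_. undefined)(j := c, k := b0)"
      have "x j = c" "x k = b0" using ne by (auto simp: x_def)
      then show ?thesis
        using u_eq[of x] gz[of x] gY[of x] b0 range_f[of "x(i := v)"] by auto
    qed
    define R where "R = {c. of_bool (c \<in> X) - u c = 1}"
    have "of_bool (c \<in> R) = of_bool (c \<in> X) - u c" for c
      using u01[of c] by (auto simp: R_def)
    then have "f (x(i := v)) = of_bool (x j \<in> R) + g x" for x
      using u_eq[of x] gz[of x] by simp
    moreover have "b \<in> R"
    proof -
      define x where "x = (\<lambda>_. undefined)(j := b)"
      have "x j = b" by (simp add: x_def)
      then have "f (x(i := z)) = 0"
        using u_eq[of x] u range_f[of "x(i := z)"] range_f[of "x(i := v)"] by auto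
      then have "b \<notin> X" using fX[of x] \<open>x j = b\<close> by (metis zero_neq_one)
      then show ?thesis using u by (simp add: R_def)
    qed
    ultimately show ?thesis by blast
  next
    fix j' m X1 Y1 assume *: "j' \<in> I" "m \<in> I" "j' \<noteq> i" "m \<noteq> i" "j' \<noteq> m" "X1 \<noteq> {}" "Y1 \<noteq> {}"
      and dv: "\<And>x. f (x(i := z)) - f (x(i := v)) = of_bool (x j' \<in> X1) - of_bool (x m \<in> Y1)"
      and fX1: "\<And>x. x j' \<in> X1 \<Longrightarrow> f (x(i := z)) = 1"
      and fY1: "\<And>x. x m \<in> Y1 \<Longrightarrow> f (x(i := v)) = 1"
    obtain a1 b1 where a1: "a1 \<in> X1" and b1: "b1 \<in> Y1" using * by blast
    have fa1: "f (x(i := z)) = 1" if "x j' = a1" for x using fX1[of x] that a1 by simp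
    have "j = j'"
      by (rule hyperplane_unique[OF I(1,2) *(1) ne(1) *(3) fa0 fa1])
    have jm: "j \<noteq> m" using \<open>j = j'\<close> * by simp
    note dv = dv[folded \<open>j = j'\<close>] and fX1 = fX1[folded \<open>j = j'\<close>]
    \<comment> \<open>Both inclusions are tested where the other terms are known: entry
      \<open>b0\<close> at \<open>k\<close> makes \<open>g\<close> vanish, entry \<open>b1\<close>
      at \<open>m\<close> makes \<open>f\<close> equal to 1 in layer \<open>v\<close>.\<close>
    have "X1 = X"
    proof (intro set_eqI iffI)
      fix c assume "c \<in> X1"
      define x where "x = (\<lambda>_. undefined)(j := c, k := b0)"
      have "x j = c" "x k = b0" using ne by (auto simp: x_def)
      then show "c \<in> X" using fX1[of x] gz[of x] gY[of x] b0 \<open>c \<in> X1\<close> by (cases "c \<in> X") auto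
    next
      fix c assume "c \<in> X"
      define x where "x = (\<lambda>_. undefined)(j := c, m := b1)"
      have "x j = c" "x m = b1" using jm by (auto simp: x_def)
      then show "c \<in> X1" using fX[of x] fY1[of x] dv[of x] b1 \<open>c \<in> X\<close> by (cases "c \<in> X1") auto
    qed
    then have gv: "f (x(i := v)) = of_bool (x m \<in> Y1) + g x" for x
      using dv[of x] gz[of x] by simp
    have gY1: "g x = 0" if "x m \<in> Y1" for x using gv[of x] fY1[of x] that by simp
    \<comment> \<open>Otherwise \<open>y\<close> could be given entry \<open>b1\<close> at
      \<open>m\<close> without changing \<open>g y = 1\<close>, but \<open>g\<close> vanishes
      there.\<close>
    have "m = k"
    proof (rule ccontr)
      assume "m \<noteq> k"
      then have "g (y(m := b1)) = g y" using g_upd *(2) jm by auto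
      then show False using gY1[of "y(m := b1)"] b1 y by simp
    qed
    then show ?thesis using gv b1 by blast
  qed
  define Z where "Z = {v. \<exists>R. R \<noteq> {} \<and> (\<forall>x. f (x(i := v)) = of_bool (x j \<in> R) + g x)}"
  have "\<exists>R. R \<noteq> {} \<and> (\<forall>x. f (x(i := v)) = of_bool (x (if v \<in> Z then j else k) \<in> R) + g x)" for v
    using layer[of v] by (cases "v \<in> Z") (auto simp: Z_def)
  then obtain R where R: "\<And>v. R v \<noteq> {}"
    and fR: "\<And>v x. f (x(i := v)) = of_bool (x (if v \<in> Z then j else k) \<in> R v) + g x"
    by metis
  define pt :: "'a \<Rightarrow> 'a \<Rightarrow> 'a \<Rightarrow> 'i \<Rightarrow> 'a" where "pt v b c = (\<lambda>_. undefined)(i := v, j := b, k := c)" for v b c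
  have pt [simp]: "pt v b c i = v" "pt v b c j = b" "pt v b c k = c"
    "(pt v b c)(i := v') = pt v' b c" "(pt v b c)(j := b') = pt v b' c" "(pt v b c)(k := c') = pt v b c'"
    for v b c v' b' c' using ne by (auto simp: pt_def fun_eq_iff)
  define G where "G b c \<longleftrightarrow> g (pt undefined b c) = 1" for b c
  have gG: "g x = of_bool (G (x j) (x k))" for x
  proof -
    have "g x = g (pt undefined (x j) (x k))" by (rule depends_onD[OF dep]) auto
    then show ?thesis using g01[of x] by (auto simp: G_def)
  qed
  have F: "f x = of_bool (if x i \<in> Z then x j \<in> R (x i) else x k \<in> R (x i)) + of_bool (G (x j) (x k))" for x
    using fR[of x "x i"] gG[of x] by simp
  have depF: "depends_on {i, j, k} f" unfolding depends_on_def F by simp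
  have zZ: "z \<in> Z" using gz a0 by (auto simp: Z_def)
  \<comment> \<open>At a point with \<open>x j\<close> in \<open>S\<close> and \<open>x k\<close>
    outside \<open>Y\<close>, the two descriptions of layer \<open>w\<close> differ by 1.\<close>
  have wZ: "w \<notin> Z"
  proof
    assume "w \<in> Z"
    then obtain S where S: "S \<noteq> {}" "\<And>x. f (x(i := w)) = of_bool (x j \<in> S) + g x" by (auto simp: Z_def)
    obtain a b where "a \<in> S" "b \<notin> Y" using S XY by blast
    then show False using S(2)[of "pt w a b"] gw[of "pt w a b"] by simp
  qed
  \<comment> \<open>The layers \<open>z\<close> and \<open>w\<close> may have indices outside
    \<open>A\<close>; \<open>retract\<close> replaces them by equal layers inside.\<close>
  obtain z' where z': "z' \<in> A" "\<And>x. f (x(i := z)) = f (x(i := z'))" using retract[of z] by blast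
  obtain w' where w': "w' \<in> A" "\<And>x. f (x(i := w)) = f (x(i := w'))" using retract[of w] by blast
  have z'Z: "z' \<in> Z" and w'Z: "w' \<notin> Z" using zZ wZ z'(2) w'(2) by (auto simp: Z_def)
  \<comment> \<open>Entry \<open>b0\<close> at \<open>k\<close> makes \<open>g\<close> vanish, so
    \<open>f\<close> tests membership in \<open>R z'\<close> and \<open>retract\<close> can be
    applied.\<close>
  obtain a where a: "a \<in> A" "a \<in> R z'"
  proof -
    obtain a1 where "a1 \<in> R z'" using R by blast
    moreover obtain a where "a \<in> A" "\<And>i x. f (x(i := a1)) = f (x(i := a))" using retract[of a1] by blast
    moreover have "f (pt z' a1 b0) = f (pt z' a b0)"
      using calculation(3)[of "pt z' a b0" j] by simp
    ultimately show ?thesis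
      using that[of a] z'Z gG[of "pt z' a1 b0"] gG[of "pt z' a b0"] gY[of "pt z' a1 b0"] gY[of "pt z' a b0"] b0
      by (auto simp: F split: if_splits)
  qed
  obtain b where b: "b \<in> A" "b \<in> R w'"
  proof -
    obtain b1 where "b1 \<in> R w'" using R by blast
    moreover obtain b where "b \<in> A" "\<And>i x. f (x(i := b1)) = f (x(i := b))" using retract[of b1] by blast
    moreover have "f (pt w' a0 b1) = f (pt w' a0 b)"
      using calculation(3)[of "pt w' a0 b" k] by simp
    ultimately show ?thesis
      using that[of b] w'Z gG[of "pt w' a0 b1"] gG[of "pt w' a0 b"] gX[of "pt w' a0 b1"] gX[of "pt w' a0 b"] a0
      by (auto simp: F split: if_splits)
  qed
  show ?thesis
  proof (rule condition1_if_three_coordinates[OF finA, of Z R G \<gamma> z' a w' b])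
    fix v x y
    have F_pt: "f (pt v x y) = of_bool (if v \<in> Z then x \<in> R v else y \<in> R v) + of_bool (G x y)" for v x y
      by (simp add: F)
    show "(\<Sum>v'\<in>A. of_bool (if v' \<in> Z then x \<in> R v' else y \<in> R v') + of_bool (G x y)) +
       (\<Sum>x'\<in>A. of_bool (if v \<in> Z then x' \<in> R v else y \<in> R v) + of_bool (G x' y)) +
       (\<Sum>y'\<in>A. of_bool (if v \<in> Z then x \<in> R v else y' \<in> R v) + of_bool (G x y')) =
       q * (of_bool (if v \<in> Z then x \<in> R v else y \<in> R v) + of_bool (G x y)) + \<gamma>"
      using lines_dep[OF _ depF, of "pt v x y"] I ne by (simp add: line_sum_def flip: F_pt)
    show "\<not> G x y" if "v \<in> Z" "x \<in> R v"
      using that range_f[of "pt v x y"] by (auto simp: F_pt)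
    show "\<not> G x y" if "v \<notin> Z" "y \<in> R v"
      using that range_f[of "pt v x y"] by (auto simp: F_pt)
  qed (use z' w' z'Z w'Z a b assms in auto)
qed

end

subsection \<open>Codes in Hamming graphs\<close>

text \<open>Neighbours are counted line by line; a vertex \<open>x\<close> of \<open>C\<close> is
  itself counted once on each of the \<open>n\<close> lines through it.\<close>

lemma card_hamming_neighbours_Int:
  assumes fin: "finite A" and C: "C \<subseteq> hamming_vertices n A" and x: "x \<in> hamming_vertices n A"
  shows "int (card {y \<in> C. hamming_adj n x y}) =
    (\<Sum>i<n. \<Sum>a\<in>A. of_bool (x[i := a] \<in> C)) - int n * of_bool (x \<in> C)"
proof -
  have l: "length x = n" and xA: "\<And>i. i < n \<Longrightarrow> x ! i \<in> A"
    using x by (auto simp: hamming_vertices_def)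
  let ?S = "SIGMA i:{..<n}. {a \<in> A - {x ! i}. x[i := a] \<in> C}"
  have "{y \<in> C. hamming_adj n x y} = C \<inter> {y \<in> hamming_vertices n A. hamming_adj n x y}"
    using C by auto
  also have "\<dots> = (\<lambda>(i, a). x[i := a]) ` ?S"
    unfolding hamming_neighbours[OF x] by auto
  finally have img: "{y \<in> C. hamming_adj n x y} = (\<lambda>(i, a). x[i := a]) ` ?S" .
  have "inj_on (\<lambda>(i, a). x[i := a]) ?S"
  proof (rule inj_onI, clarsimp)
    fix i a j b assume *: "i < n" "a \<noteq> x ! i" "j < n" "b \<noteq> x ! j" "x[i := a] = x[j := b]"
    have "i = j" using * l by (metis nth_list_update_eq nth_list_update_neq)
    moreover have "a = b" using * l \<open>i = j\<close> by (metis nth_list_update_eq)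
    ultimately show "i = j \<and> a = b" ..
  qed
  then have "int (card {y \<in> C. hamming_adj n x y}) =
      (\<Sum>i<n. int (card {a \<in> A - {x ! i}. x[i := a] \<in> C}))"
    unfolding img using fin by (simp add: card_image)
  also have "\<dots> = (\<Sum>i<n. (\<Sum>a\<in>A. of_bool (x[i := a] \<in> C)) - of_bool (x \<in> C))"
  proof (intro sum.cong refl)
    fix i assume "i \<in> {..<n}"
    then have "(\<Sum>a\<in>A. of_bool (x[i := a] \<in> C)) =
        of_bool (x[i := x ! i] \<in> C) + (\<Sum>a\<in>A - {x ! i}. of_bool (x[i := a] \<in> C) :: int)"
      using fin xA by (intro sum.remove) auto
    then show "int (card {a \<in> A - {x ! i}. x[i := a] \<in> C}) =
        (\<Sum>a\<in>A. of_bool (x[i := a] \<in> C)) - of_bool (x \<in> C)"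
      using fin by (simp add: Int_def)
  qed
  also have "\<dots> = (\<Sum>i<n. \<Sum>a\<in>A. of_bool (x[i := a] \<in> C)) - int n * of_bool (x \<in> C)"
    by (simp only: sum_subtractf sum_constant card_lessThan)
  finally show ?thesis .
qed

text \<open>The conditions inside and outside \<open>C\<close> merge into one equation, because
  \<open>n q - \<beta> = (n - 2) q + \<gamma>\<close>.\<close>

lemma crc1_hamming_iff:
  fixes \<beta> \<gamma> :: int
  assumes fin: "finite A" and ne: "A \<noteq> {}" and \<beta>: "\<beta> + \<gamma> = 2 * int (card A)"
    and C: "C \<subseteq> hamming_vertices n A"
  shows "crc1 (hamming_vertices n A) (hamming_adj n) (hamming_degree n (card A)) C \<beta> \<gamma> \<longleftrightarrow>
    C \<noteq> {} \<and> C \<noteq> hamming_vertices n A \<and> \<gamma> \<ge> 1 \<and>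
    (\<forall>x\<in>hamming_vertices n A. (\<Sum>i<n. \<Sum>a\<in>A. of_bool (x[i := a] \<in> C)) =
      (int n - 2) * int (card A) * of_bool (x \<in> C) + \<gamma>)"
proof -
  let ?V = "hamming_vertices n A"
  let ?S = "\<lambda>x. (\<Sum>i<n. \<Sum>a\<in>A. of_bool (x[i := a] \<in> C)) :: int"
  have reg: "regular_graph ?V (hamming_adj n) (hamming_degree n (card A))"
    by (rule hamming_regular[OF fin])
  have deg: "int (hamming_degree n (card A)) = int n * (int (card A) - 1)"
    using fin ne by (simp add: hamming_degree_def of_nat_diff card_gt_0_iff Suc_leI)
  have in_C: "int (card {w \<in> ?V - C. hamming_adj n x w}) = int n * int (card A) - ?S x" if "x \<in> C" for x
  proof -
    have "card {w \<in> ?V. hamming_adj n x w} = hamming_degree n (card A)"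
      using reg that C by (auto simp: regular_graph_def)
    moreover have "{w \<in> ?V. hamming_adj n x w} = {w \<in> ?V - C. hamming_adj n x w} \<union> {w \<in> C. hamming_adj n x w}"
      using C by auto
    moreover have "finite ?V" using reg by (simp add: regular_graph_def)
    then have "card ({w \<in> ?V - C. hamming_adj n x w} \<union> {w \<in> C. hamming_adj n x w}) =
        card {w \<in> ?V - C. hamming_adj n x w} + card {w \<in> C. hamming_adj n x w}"
      using C by (intro card_Un_disjoint) (auto intro: finite_subset)
    ultimately have "int (card {w \<in> ?V - C. hamming_adj n x w}) + int (card {w \<in> C. hamming_adj n x w})
        = int n * (int (card A) - 1)"
      using deg by (metis of_nat_add)
    then show ?thesis
      using card_hamming_neighbours_Int[OF fin C, of x] that C by (auto simp: algebra_simps simp del: sum_of_bool_eq)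
  qed
  have out_C: "int (card {w \<in> C. hamming_adj n x w}) = ?S x" if "x \<in> ?V - C" for x
    using card_hamming_neighbours_Int[OF fin C, of x] that by (simp del: sum_of_bool_eq)
  have 1: "int n * int (card A) - ?S x = \<beta> \<longleftrightarrow> ?S x = (int n - 2) * int (card A) * of_bool (x \<in> C) + \<gamma>"
    if "x \<in> C" for x
    using \<beta> that by (auto simp: algebra_simps simp del: sum_of_bool_eq)
  have "(\<forall>x\<in>?V. ?S x = (int n - 2) * int (card A) * of_bool (x \<in> C) + \<gamma>) \<longleftrightarrow>
      (\<forall>x\<in>C. ?S x = (int n - 2) * int (card A) * of_bool (x \<in> C) + \<gamma>) \<and>
      (\<forall>x\<in>?V - C. ?S x = (int n - 2) * int (card A) * of_bool (x \<in> C) + \<gamma>)"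
    using C by blast
  also have "\<dots> \<longleftrightarrow> (\<forall>x\<in>C. int (card {w \<in> ?V - C. hamming_adj n x w}) = \<beta>) \<and>
      (\<forall>x\<in>?V - C. int (card {w \<in> C. hamming_adj n x w}) = \<gamma>)"
    using in_C out_C 1 by (intro conj_cong ball_cong refl) (simp_all del: sum_of_bool_eq)
  finally show ?thesis using reg C by (auto simp: crc1_def simp del: sum_of_bool_eq)
qed

lemma crc1_has_eigenvalue_hamming_2:
  assumes "q \<ge> 1"
  shows "crc1_has_eigenvalue (hamming_degree n q) \<beta> \<gamma> (hamming_eigenvalue 2 n q) \<longleftrightarrow> \<beta> + \<gamma> = 2 * int q"
  using assms
  by (auto simp: crc1_has_eigenvalue_def hamming_degree_def hamming_eigenvalue_def of_nat_diff algebra_simps)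

text \<open>The indicator of \<open>C\<close> becomes total by reading every entry outside
  \<open>A\<close> as a fixed element \<open>a0\<close>.\<close>

lemma second_eigenvalue_code_of_crc1:
  fixes \<beta> \<gamma> :: int
  assumes fin: "finite A" and ne: "A \<noteq> {}" and \<beta>: "\<beta> + \<gamma> = 2 * int (card A)"
    and crc: "crc1 (hamming_vertices n A) (hamming_adj n) (hamming_degree n (card A)) C \<beta> \<gamma>"
  shows "\<exists>f. second_eigenvalue_code A {..<n} f \<gamma> \<and> (\<exists>x. f x = 1)"
proof -
  let ?V = "hamming_vertices n A"
  obtain a0 where a0: "a0 \<in> A" using ne by blast
  define \<rho> where "\<rho> a = (if a \<in> A then a else a0)" for a
  have \<rho>: "\<rho> a \<in> A" "\<rho> (\<rho> a) = \<rho> a" for a using a0 by (auto simp: \<rho>_def)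
  define word where "word x = map (\<lambda>i. \<rho> (x i)) [0..<n]" for x
  define f :: "(nat \<Rightarrow> 'a) \<Rightarrow> int" where "f x = of_bool (word x \<in> C)" for x
  have word_upd: "word (x(i := a)) = (word x)[i := \<rho> a]" for x i a
    unfolding word_def by (rule nth_equalityI) (auto simp: nth_list_update)
  have word_V: "word x \<in> ?V" for x using \<rho> by (auto simp: hamming_vertices_def word_def)
  have C: "C \<subseteq> ?V" "C \<noteq> {}" using crc by (auto simp: crc1_def)
  have lines: "(\<Sum>i<n. \<Sum>a\<in>A. of_bool (x[i := a] \<in> C)) =
      (int n - 2) * int (card A) * of_bool (x \<in> C) + \<gamma>" if "x \<in> ?V" for x
    using crc1_hamming_iff[OF fin ne \<beta> C(1)] crc that by blast
  have "second_eigenvalue_code A {..<n} f \<gamma>"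
  proof
    show "depends_on {..<n} f"
    proof -
      have "word x = word y" if "\<forall>i\<in>{..<n}. x i = y i" for x y using that by (auto simp: word_def)
      then show ?thesis unfolding depends_on_def f_def by metis
    qed
    show "\<exists>a'\<in>A. \<forall>i x. f (x(i := a)) = f (x(i := a'))" for a
      using \<rho> by (intro bexI[of _ "\<rho> a"]) (auto simp: f_def word_upd)
    show "(\<Sum>m\<in>{..<n}. line_sum A m f x) = (int (card {..<n}) - 2) * int (card A) * f x + \<gamma>" for x
    proof -
      have "line_sum A m f x = (\<Sum>a\<in>A. of_bool ((word x)[m := a] \<in> C))" for m
        unfolding line_sum_def f_def word_upd by (intro sum.cong) (auto simp: \<rho>_def)
      then show ?thesis using lines[OF word_V[of x]] by (simp add: f_def del: sum_of_bool_eq)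
    qed
  qed (use fin in \<open>auto simp: f_def\<close>)
  moreover obtain c where "c \<in> C" using C by blast
  then have "c \<in> ?V" using C by blast
  then have "length c = n" "\<And>i. i < n \<Longrightarrow> c ! i \<in> A"
    by (auto simp: hamming_vertices_def)
  then have "word (\<lambda>i. c ! i) = c"
    unfolding word_def by (intro nth_equalityI) (auto simp: \<rho>_def)
  then have "f (\<lambda>i. c ! i) = 1" using \<open>c \<in> C\<close> by (simp add: f_def)
  ultimately show ?thesis by blast
qed

text \<open>A pattern on the first \<open>m\<close> positions extends to length \<open>n\<close>
  because each further direction adds \<open>q\<close> times the indicator.\<close>

lemma crc1_hamming_of_pattern:
  fixes \<gamma> :: int and P :: "'a list \<Rightarrow> bool"
  assumes fin: "finite A" and ne: "A \<noteq> {}" and "m \<le> n" and \<gamma>: "1 \<le> \<gamma>" "\<gamma> < 2 * int (card A)"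
    and P: "\<And>x. x \<in> hamming_vertices m A \<Longrightarrow> (\<Sum>i<m. \<Sum>a\<in>A. of_bool (P (x[i := a]))) =
      (int m - 2) * int (card A) * of_bool (P x) + \<gamma>"
  shows "\<exists>C. crc1 (hamming_vertices n A) (hamming_adj n) (hamming_degree n (card A)) C (2 * int (card A) - \<gamma>) \<gamma>"
proof -
  let ?V = "hamming_vertices n A"
  define C where "C = {x \<in> ?V. P (take m x)}"
  have upd: "x[i := a] \<in> ?V" if "x \<in> ?V" "a \<in> A" for x i a
    using that set_update_subset_insert[of x i a] by (auto simp: hamming_vertices_def)
  have lines: "(\<Sum>i<n. \<Sum>a\<in>A. of_bool (x[i := a] \<in> C)) =
      (int n - 2) * int (card A) * of_bool (x \<in> C) + \<gamma>" if x: "x \<in> ?V" for x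
  proof -
    have t: "take m x \<in> hamming_vertices m A"
      using x \<open>m \<le> n\<close> set_take_subset[of m x] by (auto simp: hamming_vertices_def)
    have "(\<Sum>i<n. \<Sum>a\<in>A. of_bool (x[i := a] \<in> C)) = (\<Sum>i<n. \<Sum>a\<in>A. of_bool (P (take m (x[i := a]))) :: int)"
      using upd[OF x] by (intro sum.cong) (auto simp: C_def)
    also have "\<dots> = (\<Sum>i<m. \<Sum>a\<in>A. of_bool (P (take m (x[i := a])))) +
        (\<Sum>i\<in>{m..<n}. \<Sum>a\<in>A. of_bool (P (take m (x[i := a]))))"
      using \<open>m \<le> n\<close> by (metis lessThan_atLeast0 sum.atLeastLessThan_concat zero_le)
    also have "(\<Sum>i<m. \<Sum>a\<in>A. of_bool (P (take m (x[i := a])))) =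
        (int m - 2) * int (card A) * of_bool (P (take m x)) + \<gamma>"
      using P[OF t] by (simp add: take_update_swap del: sum_of_bool_eq)
    also have "(\<Sum>i\<in>{m..<n}. \<Sum>a\<in>A. of_bool (P (take m (x[i := a])))) =
        (\<Sum>i\<in>{m..<n}. int (card A) * of_bool (P (take m x)))"
      by (intro sum.cong refl) simp
    also have "\<dots> = (int n - int m) * (int (card A) * of_bool (P (take m x)))"
      using \<open>m \<le> n\<close> by (simp add: of_nat_diff)
    finally show ?thesis using x by (simp add: C_def algebra_simps del: sum_of_bool_eq)
  qed
  obtain a where "a \<in> A" using ne by blast
  then have pt: "replicate n a \<in> ?V" by (auto simp: hamming_vertices_def)
  \<comment> \<open>For empty \<open>C\<close> the equation reads \<open>0 = \<gamma>\<close>; for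
    \<open>C = ?V\<close> it reads \<open>n q = (n - 2) q + \<gamma>\<close>, against
    \<open>\<gamma> < 2 q\<close>.\<close>
  have "C \<noteq> {}" using lines[OF pt] \<gamma> by auto
  moreover have "C \<noteq> ?V"
  proof
    assume "C = ?V"
    then have "(\<Sum>i<n. \<Sum>a'\<in>A. of_bool ((replicate n a)[i := a'] \<in> C)) = (\<Sum>i<n. \<Sum>a'\<in>A. 1 :: int)"
      using upd[OF pt] by (intro sum.cong) auto
    then show False using lines[OF pt] \<open>C = ?V\<close> pt \<gamma> by (simp add: algebra_simps del: sum_of_bool_eq)
  qed
  ultimately show ?thesis
    using crc1_hamming_iff[OF fin ne, of "2 * int (card A) - \<gamma>" \<gamma> C n] lines \<gamma>
    by (intro exI[of _ C]) (simp add: C_def del: sum_of_bool_eq)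
qed

subsection \<open>Constructions\<close>

lemma biregular_nat:
  fixes m k a b :: nat
  assumes "m * a = k * b" "a \<le> k"
  shows "\<exists>B. (\<forall>i<m. card {j. j < k \<and> B i j} = a) \<and> (\<forall>j<k. card {i. i < m \<and> B i j} = b)"
proof -
  text \<open>Row \<open>i\<close> consists of the residues modulo \<open>k\<close> of the \<open>i\<close>-th block of \<open>a\<close> consecutive numbers.\<close>
  define B where "B i j \<longleftrightarrow> (\<exists>s<a. (i * a + s) mod k = j)" for i j
  have "card {j. j < k \<and> B i j} = a" if "i < m" for i
  proof (cases "a = 0")
    case False
    then have "k > 0" using assms by linarith
    have "{j. j < k \<and> B i j} = (\<lambda>s. (i * a + s) mod k) ` {..<a}"
      using \<open>k > 0\<close> by (auto simp: B_def)
    moreover have "inj_on (\<lambda>s. (i * a + s) mod k) {..<a}"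
    proof (rule linorder_inj_onI')
      fix s s' assume *: "s \<in> {..<a}" "s' \<in> {..<a}" "s < s'"
      show "(i * a + s) mod k \<noteq> (i * a + s') mod k"
      proof
        assume "(i * a + s) mod k = (i * a + s') mod k"
        then have "k dvd (i * a + s') - (i * a + s)" using * by (metis mod_eq_dvd_iff_nat add_le_cancel_left less_imp_le_nat)
        then have "k dvd s' - s" by simp
        then show False using * assms(2) by (auto dest: dvd_imp_le)
      qed
    qed
    ultimately show ?thesis by (simp add: card_image)
  qed (simp add: B_def)
  moreover have "card {i. i < m \<and> B i j} = b" if "j < k" for j
  proof (cases "a = 0")
    case True
    then show ?thesis using assms(1) that by (simp add: B_def)
  next
    case False
    \<comment> \<open>The numbers below \<open>m * a = k * b\<close> with residue \<open>j\<close>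
      are \<open>k * u + j\<close> with \<open>u < b\<close>. The row of such a number is its
      quotient by \<open>a\<close>, and \<open>a \<le> k\<close> keeps these rows distinct.\<close>
    have "{i. i < m \<and> B i j} = (\<lambda>u. (k * u + j) div a) ` {..<b}"
    proof (intro equalityI subsetI)
      fix i assume "i \<in> {i. i < m \<and> B i j}"
      then obtain s where s: "i < m" "s < a" "(i * a + s) mod k = j" by (auto simp: B_def)
      define u where "u = (i * a + s) div k"
      have eq: "k * u + j = i * a + s" using s(3) unfolding u_def by (metis mult_div_mod_eq)
      have "Suc i * a \<le> m * a" using s(1) by (intro mult_right_mono) auto
      then have "a + i * a \<le> k * b" using assms(1) by simp
      then have "k * u < k * b" using eq s(2) by linarith
      then have "u < b" by simp
      moreover have "(k * u + j) div a = i" using eq s(2) by simp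
      ultimately show "i \<in> (\<lambda>u. (k * u + j) div a) ` {..<b}" by force
    next
      fix i assume "i \<in> (\<lambda>u. (k * u + j) div a) ` {..<b}"
      then obtain u where u: "u < b" "i = (k * u + j) div a" by auto
      have "k * Suc u \<le> k * b" using u(1) by (intro mult_left_mono) auto
      then have "k * u + j < m * a" using that assms(1) by simp
      then have "i < m" using u(2) False by (simp add: div_less_iff_less_mult)
      moreover have "(i * a + (k * u + j) mod a) mod k = j"
        using u(2) that by (metis div_mult_mod_eq mod_less mod_mult_self4)
      ultimately show "i \<in> {i. i < m \<and> B i j}"
        using False unfolding B_def by (auto intro!: exI[of _ "(k * u + j) mod a"])
    qed
    moreover have "inj_on (\<lambda>u. (k * u + j) div a) {..<b}"
    proof (rule linorder_inj_onI')
      fix u u' :: nat assume "u < u'"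
      then have "k * Suc u \<le> k * u'" by (intro mult_left_mono) auto
      then have "k * u + j + a \<le> k * u' + j" using assms(2) by simp
      then have "(k * u + j + a) div a \<le> (k * u' + j) div a" by (rule div_le_mono)
      then show "(k * u + j) div a \<noteq> (k * u' + j) div a" using False by simp
    qed
    ultimately show ?thesis by (simp add: card_image)
  qed
  ultimately show ?thesis by blast
qed

lemma biregular_exists:
  fixes P :: "'a set" and Q :: "'b set"
  assumes "finite P" "finite Q" "card P * a = card Q * b" "a \<le> card Q"
  obtains B where "\<And>x. x \<in> P \<Longrightarrow> card {y \<in> Q. B x y} = a" "\<And>y. y \<in> Q \<Longrightarrow> card {x \<in> P. B x y} = b"
proof -
  obtain h where h: "bij_betw h P {0..<card P}" using ex_bij_betw_finite_nat[OF assms(1)] by blast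
  obtain g where g: "bij_betw g Q {0..<card Q}" using ex_bij_betw_finite_nat[OF assms(2)] by blast
  obtain B where B: "\<And>i. i < card P \<Longrightarrow> card {j. j < card Q \<and> B i j} = a"
    "\<And>j. j < card Q \<Longrightarrow> card {i. i < card P \<and> B i j} = b"
    using biregular_nat[OF assms(3,4)] by blast
  have pull: "card {y \<in> S. R (e y)} = card {j. j < N \<and> R j}" if "bij_betw e S {0..<N}"
    for S :: "'c set" and e and N :: nat and R
  proof -
    have "inj_on e S" and img: "e ` S = {0..<N}" using that by (auto simp: bij_betw_def)
    have "{j. j < N \<and> R j} = {j \<in> e ` S. R j}" unfolding img by auto
    also have "\<dots> = e ` {y \<in> S. R (e y)}" by auto
    finally have "bij_betw e {y \<in> S. R (e y)} {j. j < N \<and> R j}"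
      using \<open>inj_on e S\<close> by (auto simp: bij_betw_def inj_on_def)
    then show ?thesis by (rule bij_betw_same_card)
  qed
  show thesis
  proof (rule that[of "\<lambda>x y. B (h x) (g y)"])
    fix x assume "x \<in> P"
    then have "h x < card P" using bij_betwE[OF h] by auto
    then show "card {y \<in> Q. B (h x) (g y)} = a" using pull[OF g, of "B (h x)"] B by simp
  next
    fix y assume "y \<in> Q"
    then have "g y < card Q" using bij_betwE[OF g] by auto
    then show "card {x \<in> P. B (h x) (g y)} = b" using pull[OF h, of "\<lambda>i. B i (g y)"] B by simp
  qed
qed

text \<open>For two coordinates the coefficient \<open>n - 2\<close> vanishes, so a relation on
  \<open>A\<close> with all row and column sums \<gamma> / 2 suffices.\<close>

lemma crc1_hamming_even:
  fixes \<gamma> :: int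
  assumes fin: "finite A" and "n \<ge> 2" "even \<gamma>" "1 \<le> \<gamma>" "\<gamma> \<le> int (card A)"
  shows "\<exists>C. crc1 (hamming_vertices n A) (hamming_adj n) (hamming_degree n (card A)) C (2 * int (card A) - \<gamma>) \<gamma>"
proof -
  obtain c where "\<gamma> = 2 * c" using \<open>even \<gamma>\<close> by blast
  with assms(4) have \<gamma>: "\<gamma> = 2 * int (nat c)" by simp
  have ne: "A \<noteq> {}" using assms by auto
  obtain B where B: "\<And>x. x \<in> A \<Longrightarrow> card {y \<in> A. B x y} = nat c" "\<And>y. y \<in> A \<Longrightarrow> card {x \<in> A. B x y} = nat c"
    using biregular_exists[OF fin fin, of "nat c" "nat c"] \<gamma> assms(5) by auto
  show ?thesis
  proof (rule crc1_hamming_of_pattern[OF fin ne \<open>n \<ge> 2\<close> assms(4), where P = "\<lambda>xs. B (xs ! 0) (xs ! 1)"])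
    show "\<gamma> < 2 * int (card A)" using assms by linarith
    fix x assume "x \<in> hamming_vertices 2 A"
    then have "x ! 0 \<in> A" "x ! 1 \<in> A" "length x = 2" by (auto simp: hamming_vertices_def)
    then show "(\<Sum>i<2. \<Sum>a\<in>A. of_bool (B (x[i := a] ! 0) (x[i := a] ! 1))) =
        (int 2 - 2) * int (card A) * of_bool (B (x ! 0) (x ! 1)) + \<gamma>"
      using B fin \<gamma> by (simp add: numeral_2_eq_2 lessThan_Suc Int_def)
  qed
qed

lemma crc1_hamming_of_ternary:
  fixes \<gamma> :: int
  assumes fin: "finite A" and ne: "A \<noteq> {}" and "n \<ge> 3" and \<gamma>: "1 \<le> \<gamma>" "\<gamma> < 2 * int (card A)"
    and F: "\<And>u x y. u \<in> A \<Longrightarrow> x \<in> A \<Longrightarrow> y \<in> A \<Longrightarrow>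
      (\<Sum>u'\<in>A. of_bool (F u' x y)) + (\<Sum>x'\<in>A. of_bool (F u x' y)) + (\<Sum>y'\<in>A. of_bool (F u x y'))
        = int (card A) * of_bool (F u x y) + \<gamma>"
  shows "\<exists>C. crc1 (hamming_vertices n A) (hamming_adj n) (hamming_degree n (card A)) C (2 * int (card A) - \<gamma>) \<gamma>"
proof (rule crc1_hamming_of_pattern[OF fin ne \<open>n \<ge> 3\<close> \<gamma>, where P = "\<lambda>xs. F (xs ! 0) (xs ! 1) (xs ! 2)"])
  fix x assume "x \<in> hamming_vertices 3 A"
  then have "x ! 0 \<in> A" "x ! 1 \<in> A" "x ! 2 \<in> A" "length x = 3" by (auto simp: hamming_vertices_def)
  moreover have "{..<3} = {0, 1, 2::nat}" by auto
  ultimately show "(\<Sum>i<3. \<Sum>a\<in>A. of_bool (F (x[i := a] ! 0) (x[i := a] ! 1) (x[i := a] ! 2))) =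
      (int 3 - 2) * int (card A) * of_bool (F (x ! 0) (x ! 1) (x ! 2)) + \<gamma>"
    using F[of "x ! 0" "x ! 1" "x ! 2"] by (simp del: sum_of_bool_eq)
qed

lemma sum_of_bool_restrict:
  assumes "finite A" "S \<subseteq> A"
  shows "(\<Sum>v\<in>A. of_bool (v \<in> S \<and> P v)) = int (card {v \<in> S. P v})"
    and "(\<Sum>v\<in>A. of_bool (v \<in> S)) = int (card S)"
proof -
  have "A \<inter> {v. v \<in> S \<and> P v} = {v \<in> S. P v}" "A \<inter> S = S" using assms(2) by auto
  then show "(\<Sum>v\<in>A. of_bool (v \<in> S \<and> P v)) = int (card {v \<in> S. P v})"
    and "(\<Sum>v\<in>A. of_bool (v \<in> S)) = int (card S)"
    using assms(1) by simp_all
qed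

text \<open>The code consists of the boxes \<open>Z \<times> X \<times> Y\<close> and
  \<open>Z' \<times> X' \<times> Y'\<close> and of full lines over a relation \<open>T\<close>
  between \<open>X\<close> and \<open>Y'\<close>. Here \<open>Z\<close>, \<open>Z'\<close> have size
  \<open>h\<close>, \<open>X\<close>, \<open>Y'\<close> size \<open>g\<close>, and \<open>T\<close>
  has degree \<open>g - h\<close>, which is where \<open>h \<le> g\<close> enters.\<close>

lemma crc1_hamming_half:
  fixes \<gamma> :: int
  assumes fin: "finite A" and "n \<ge> 3" and q: "card A = 2 * h" and "1 \<le> \<gamma>" "int h \<le> \<gamma>" "\<gamma> \<le> int (card A)"
  shows "\<exists>C. crc1 (hamming_vertices n A) (hamming_adj n) (hamming_degree n (card A)) C (2 * int (card A) - \<gamma>) \<gamma>"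
proof -
  define g where "g = nat \<gamma>"
  have g: "\<gamma> = int g" "h \<le> g" "g \<le> card A" using assms by (auto simp: g_def)
  have ne: "A \<noteq> {}" using assms by auto
  obtain Z where Z: "Z \<subseteq> A" "card Z = h" by (rule obtain_subset_with_card_n[of h A]) (use q in auto)
  obtain X where X: "X \<subseteq> A" "card X = g" by (rule obtain_subset_with_card_n[of g A]) (use g in auto)
  obtain Y' where Y': "Y' \<subseteq> A" "card Y' = g" by (rule obtain_subset_with_card_n[of g A]) (use g in auto)
  define Z' X' Y where "Z' = A - Z" and "X' = A - X" and "Y = A - Y'"
  have sub: "Z' \<subseteq> A" "X' \<subseteq> A" "Y \<subseteq> A" by (auto simp: Z'_def X'_def Y_def)
  have cards: "card Z' = h" "card X' = card A - g" "card Y = card A - g"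
    unfolding Z'_def X'_def Y_def using Z X Y' fin q by (simp_all add: card_Diff_subset finite_subset)
  have mem: "u \<in> Z' \<longleftrightarrow> u \<notin> Z" "u \<in> X' \<longleftrightarrow> u \<notin> X" "u \<in> Y' \<longleftrightarrow> u \<notin> Y" if "u \<in> A" for u
    using that Y' by (auto simp: Z'_def X'_def Y_def)
  obtain T where T: "\<And>x. x \<in> X \<Longrightarrow> card {y \<in> Y'. T x y} = g - h" "\<And>y. y \<in> Y' \<Longrightarrow> card {x \<in> X. T x y} = g - h"
    using biregular_exists[of X Y' "g - h" "g - h"] X Y' fin by (auto simp: finite_subset)
  define F where "F u x y \<longleftrightarrow> (u \<in> Z \<and> x \<in> X \<and> y \<in> Y) \<or> (u \<in> Z' \<and> x \<in> X' \<and> y \<in> Y') \<or>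
    (x \<in> X \<and> y \<in> Y' \<and> T x y)" for u x y
  have F_sum: "of_bool (F u x y) = of_bool (u \<in> Z \<and> x \<in> X \<and> y \<in> Y) + of_bool (u \<in> Z' \<and> x \<in> X' \<and> y \<in> Y') +
      (of_bool (x \<in> X \<and> y \<in> Y' \<and> T x y) :: int)" if "u \<in> A" "x \<in> A" "y \<in> A" for u x y
    unfolding F_def mem[OF that(1)] mem[OF that(2)] mem[OF that(3)] by auto
  show ?thesis
  proof (rule crc1_hamming_of_ternary[OF fin ne \<open>n \<ge> 3\<close> assms(4)])
    show "\<gamma> < 2 * int (card A)" using assms by linarith
    fix u x y assume *: "u \<in> A" "x \<in> A" "y \<in> A"
    note mem = mem[OF *(1)] mem[OF *(2)] mem[OF *(3)]
    have "(\<Sum>u'\<in>A. of_bool (F u' x y)) = int h * of_bool (x \<in> X \<and> y \<in> Y) + int h * of_bool (x \<notin> X \<and> y \<notin> Y) +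
        int (card A) * of_bool (x \<in> X \<and> y \<notin> Y \<and> T x y)"
    proof -
      have "(\<Sum>u'\<in>A. of_bool (F u' x y)) = (\<Sum>u'\<in>A. of_bool (u' \<in> Z \<and> x \<in> X \<and> y \<in> Y)) +
         (\<Sum>u'\<in>A. of_bool (u' \<in> Z' \<and> x \<in> X' \<and> y \<in> Y')) + (\<Sum>u'\<in>A. of_bool (x \<in> X \<and> y \<in> Y' \<and> T x y) :: int)"
        using * F_sum by (simp add: sum.distrib del: sum_of_bool_eq)
      then show ?thesis
        using * Z sub cards mem fin
        by (cases "u \<in> Z"; cases "x \<in> X"; cases "y \<in> Y") (simp_all add: sum_of_bool_restrict del: sum_of_bool_eq)
    qed
    moreover have "(\<Sum>x'\<in>A. of_bool (F u x' y)) = int g * of_bool (u \<in> Z \<and> y \<in> Y) +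
        int (card A - g) * of_bool (u \<notin> Z \<and> y \<notin> Y) + int (g - h) * of_bool (y \<notin> Y)"
    proof -
      have "(\<Sum>x'\<in>A. of_bool (F u x' y)) = (\<Sum>x'\<in>A. of_bool (x' \<in> X \<and> u \<in> Z \<and> y \<in> Y)) +
         (\<Sum>x'\<in>A. of_bool (x' \<in> X' \<and> u \<in> Z' \<and> y \<in> Y')) + (\<Sum>x'\<in>A. of_bool (x' \<in> X \<and> y \<in> Y' \<and> T x' y) :: int)"
        using * F_sum by (simp add: sum.distrib conj_left_commute del: sum_of_bool_eq)
      then show ?thesis
        using * X sub cards mem fin T
        by (cases "u \<in> Z"; cases "x \<in> X"; cases "y \<in> Y") (simp_all add: sum_of_bool_restrict del: sum_of_bool_eq)
    qed
    moreover have "(\<Sum>y'\<in>A. of_bool (F u x y')) = int (card A - g) * of_bool (u \<in> Z \<and> x \<in> X) +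
        int g * of_bool (u \<notin> Z \<and> x \<notin> X) + int (g - h) * of_bool (x \<in> X)"
    proof -
      have "(\<Sum>y'\<in>A. of_bool (F u x y')) = (\<Sum>y'\<in>A. of_bool (y' \<in> Y \<and> u \<in> Z \<and> x \<in> X)) +
         (\<Sum>y'\<in>A. of_bool (y' \<in> Y' \<and> u \<in> Z' \<and> x \<in> X')) + (\<Sum>y'\<in>A. of_bool (y' \<in> Y' \<and> x \<in> X \<and> T x y') :: int)"
        using * F_sum by (simp add: sum.distrib conj_ac del: sum_of_bool_eq)
      then show ?thesis
        using * Y' sub cards mem fin T
        by (cases "u \<in> Z"; cases "x \<in> X"; cases "y \<in> Y") (simp_all add: sum_of_bool_restrict del: sum_of_bool_eq)
    qed
    ultimately show "(\<Sum>u'\<in>A. of_bool (F u' x y)) + (\<Sum>x'\<in>A. of_bool (F u x' y)) + (\<Sum>y'\<in>A. of_bool (F u x y'))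
        = int (card A) * of_bool (F u x y) + \<gamma>"
      unfolding F_sum[OF *] using * g q
      by (cases "u \<in> Z"; cases "x \<in> X"; cases "y \<in> Y") (simp_all add: mem of_nat_diff algebra_simps del: sum_of_bool_eq)
  qed
qed

text \<open>Reverses the counting in \<open>condition1_if_three_coordinates\<close>: three biregular
  graphs on parts of sizes \<open>r\<close>, \<open>s\<close>, \<open>t\<close> and their
  complements define lines in three directions. Any two of the graphs use complementary parts in
  their common coordinate, so the lines are disjoint.\<close>

lemma crc1_hamming_condition1:
  fixes \<gamma> :: int
  assumes fin: "finite A" and "n \<ge> 3" and cond: "condition1 (int (card A)) \<gamma>" and "\<gamma> < 2 * int (card A)"
  shows "\<exists>C. crc1 (hamming_vertices n A) (hamming_adj n) (hamming_degree n (card A)) C (2 * int (card A) - \<gamma>) \<gamma>"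
proof -
  let ?q = "int (card A)"
  obtain r' s' t' a' b' c' where *: "0 < r'" "r' < ?q" "0 < s'" "s' < ?q" "0 < t'" "t' < ?q"
    "0 < c'" "c' \<le> min (?q - s') (?q - t')" "0 < b'" "b' \<le> min t' (?q - r')" "0 < a'" "a' \<le> min r' s'"
    "c' * r' = a' * (?q - t')" "b' * (?q - s') = c' * (?q - r')" "a' * t' = b' * s'" "\<gamma> = a' + b' + c'"
    using cond unfolding condition1_def by blast
  define r s t a b c where "r = nat r'" and "s = nat s'" and "t = nat t'" and "a = nat a'" and "b = nat b'" and "c = nat c'"
  have ints: "r' = int r" "s' = int s" "t' = int t" "a' = int a" "b' = int b" "c' = int c"
    using * by (simp_all add: r_def s_def t_def a_def b_def c_def)
  have lt: "r < card A" "s < card A" "t < card A" using * by (simp_all add: ints)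
  have le: "c \<le> card A - t" "c \<le> card A - s" "a \<le> s"
    using *(8,12) lt unfolding ints min.bounded_iff by linarith+
  have eqs: "r * c = (card A - t) * a" "(card A - r) * c = (card A - s) * b" "t * a = s * b"
    using *(13-15) lt
    by (simp_all add: ints mult.commute flip: of_nat_diff of_nat_mult)
  have \<gamma>: "\<gamma> = int a + int b + int c" using * by (simp add: ints)
  have ne: "A \<noteq> {}" using lt by auto
  obtain Z where Z: "Z \<subseteq> A" "card Z = r" by (rule obtain_subset_with_card_n[of r A]) (use lt in auto)
  obtain X' where X': "X' \<subseteq> A" "card X' = t" by (rule obtain_subset_with_card_n[of t A]) (use lt in auto)
  obtain Y' where Y': "Y' \<subseteq> A" "card Y' = s" by (rule obtain_subset_with_card_n[of s A]) (use lt in auto)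
  define Z' X Y where "Z' = A - Z" and "X = A - X'" and "Y = A - Y'"
  have sub: "Z' \<subseteq> A" "X \<subseteq> A" "Y \<subseteq> A" by (auto simp: Z'_def X_def Y_def)
  have cards: "card Z' = card A - r" "card X = card A - t" "card Y = card A - s"
    unfolding Z'_def X_def Y_def using Z X' Y' fin by (simp_all add: card_Diff_subset finite_subset)
  have fins: "finite Z" "finite Z'" "finite X" "finite X'" "finite Y" "finite Y'"
    using fin Z X' Y' sub by (auto intro: finite_subset)
  have mem: "u \<in> Z' \<longleftrightarrow> u \<notin> Z" "u \<in> X' \<longleftrightarrow> u \<notin> X" "u \<in> Y' \<longleftrightarrow> u \<notin> Y" if "u \<in> A" for u
    using that X' Y' by (auto simp: Z'_def X_def Y_def)
  obtain B1 where B1: "\<And>u. u \<in> Z \<Longrightarrow> card {x \<in> X. B1 u x} = c" "\<And>x. x \<in> X \<Longrightarrow> card {u \<in> Z. B1 u x} = a"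
    using biregular_exists[of Z X c a] fins Z cards eqs le by auto
  obtain B2 where B2: "\<And>u. u \<in> Z' \<Longrightarrow> card {y \<in> Y. B2 u y} = c" "\<And>y. y \<in> Y \<Longrightarrow> card {u \<in> Z'. B2 u y} = b"
    using biregular_exists[of Z' Y c b] fins cards eqs le by auto
  obtain B3 where B3: "\<And>x. x \<in> X' \<Longrightarrow> card {y \<in> Y'. B3 x y} = a" "\<And>y. y \<in> Y' \<Longrightarrow> card {x \<in> X'. B3 x y} = b"
    using biregular_exists[of X' Y' a b] fins X' Y' eqs le by auto
  define F where "F u x y \<longleftrightarrow> (u \<in> Z \<and> x \<in> X \<and> B1 u x) \<or> (u \<in> Z' \<and> y \<in> Y \<and> B2 u y) \<or>
    (x \<in> X' \<and> y \<in> Y' \<and> B3 x y)" for u x y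
  have F_sum: "of_bool (F u x y) = of_bool (u \<in> Z \<and> x \<in> X \<and> B1 u x) + of_bool (u \<in> Z' \<and> y \<in> Y \<and> B2 u y) +
      (of_bool (x \<in> X' \<and> y \<in> Y' \<and> B3 x y) :: int)" if "u \<in> A" "x \<in> A" "y \<in> A" for u x y
    unfolding F_def mem[OF that(1)] mem[OF that(2)] mem[OF that(3)] by auto
  show ?thesis
  proof (rule crc1_hamming_of_ternary[OF fin ne \<open>n \<ge> 3\<close> _ assms(4)])
    show "1 \<le> \<gamma>" using \<gamma> * by simp
    fix u x y assume *: "u \<in> A" "x \<in> A" "y \<in> A"
    note mem = mem[OF *(1)] mem[OF *(2)] mem[OF *(3)]
    have "(\<Sum>u'\<in>A. of_bool (F u' x y)) = int a * of_bool (x \<in> X) + int b * of_bool (y \<in> Y) +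
        int (card A) * of_bool (x \<notin> X \<and> y \<notin> Y \<and> B3 x y)"
    proof -
      have "(\<Sum>u'\<in>A. of_bool (F u' x y)) = (\<Sum>u'\<in>A. of_bool (u' \<in> Z \<and> x \<in> X \<and> B1 u' x)) +
         (\<Sum>u'\<in>A. of_bool (u' \<in> Z' \<and> y \<in> Y \<and> B2 u' y)) + (\<Sum>u'\<in>A. of_bool (x \<in> X' \<and> y \<in> Y' \<and> B3 x y) :: int)"
        using * F_sum by (simp add: sum.distrib del: sum_of_bool_eq)
      then show ?thesis
        using * Z sub B1 B2 mem fin
        by (cases "u \<in> Z"; cases "x \<in> X"; cases "y \<in> Y") (simp_all add: sum_of_bool_restrict del: sum_of_bool_eq)
    qed
    moreover have "(\<Sum>x'\<in>A. of_bool (F u x' y)) = int c * of_bool (u \<in> Z) +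
        int (card A) * of_bool (u \<notin> Z \<and> y \<in> Y \<and> B2 u y) + int b * of_bool (y \<notin> Y)"
    proof -
      have "(\<Sum>x'\<in>A. of_bool (F u x' y)) = (\<Sum>x'\<in>A. of_bool (x' \<in> X \<and> u \<in> Z \<and> B1 u x')) +
         (\<Sum>x'\<in>A. of_bool (u \<in> Z' \<and> y \<in> Y \<and> B2 u y)) + (\<Sum>x'\<in>A. of_bool (x' \<in> X' \<and> y \<in> Y' \<and> B3 x' y) :: int)"
        using * F_sum by (simp add: sum.distrib conj_left_commute del: sum_of_bool_eq)
      then show ?thesis
        using * X' sub B1 B3 mem fin
        by (cases "u \<in> Z"; cases "x \<in> X"; cases "y \<in> Y") (simp_all add: sum_of_bool_restrict del: sum_of_bool_eq)
    qed
    moreover have "(\<Sum>y'\<in>A. of_bool (F u x y')) = int (card A) * of_bool (u \<in> Z \<and> x \<in> X \<and> B1 u x) +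
        int c * of_bool (u \<notin> Z) + int a * of_bool (x \<notin> X)"
    proof -
      have "(\<Sum>y'\<in>A. of_bool (F u x y')) = (\<Sum>y'\<in>A. of_bool (u \<in> Z \<and> x \<in> X \<and> B1 u x)) +
         (\<Sum>y'\<in>A. of_bool (y' \<in> Y \<and> u \<in> Z' \<and> B2 u y')) + (\<Sum>y'\<in>A. of_bool (y' \<in> Y' \<and> x \<in> X' \<and> B3 x y') :: int)"
        using * F_sum by (simp add: sum.distrib conj_left_commute del: sum_of_bool_eq)
      then show ?thesis
        using * Y' sub B2 B3 mem fin
        by (cases "u \<in> Z"; cases "x \<in> X"; cases "y \<in> Y") (simp_all add: sum_of_bool_restrict del: sum_of_bool_eq)
    qed
    ultimately show "(\<Sum>u'\<in>A. of_bool (F u' x y)) + (\<Sum>x'\<in>A. of_bool (F u x' y)) + (\<Sum>y'\<in>A. of_bool (F u x y'))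
        = int (card A) * of_bool (F u x y) + \<gamma>"
      unfolding F_sum[OF *] using * \<gamma>
      by (cases "u \<in> Z"; cases "x \<in> X"; cases "y \<in> Y") (simp_all add: mem algebra_simps del: sum_of_bool_eq)
  qed
qed

theorem theorem8:
  fixes A :: "'a set" and n q :: nat and \<gamma> :: int
  assumes "n \<ge> 1" and "q \<ge> 2" and "card A = q"
  shows "(\<exists>C \<beta>. crc1 (hamming_vertices n A) (hamming_adj n) (hamming_degree n q) C \<beta> \<gamma> \<and>
            crc1_has_eigenvalue (hamming_degree n q) \<beta> \<gamma> (hamming_eigenvalue 2 n q) \<and>
            \<gamma> \<le> \<beta>) \<longleftrightarrow>
         (n \<ge> 2 \<and> even \<gamma> \<and> 1 \<le> \<gamma> \<and> \<gamma> \<le> int q) \<or>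
         (n \<ge> 3 \<and> even q \<and> real q / 2 \<le> real_of_int \<gamma> \<and> \<gamma> \<le> int q) \<or>
         (n \<ge> 3 \<and> even q \<and> odd \<gamma> \<and> real_of_int \<gamma> \<le> real q / 2 \<and> condition1 (int q) \<gamma>)"
    (is "?L \<longleftrightarrow> ?R")
proof
  have fin: "finite A" and ne: "A \<noteq> {}" using assms by (auto intro: card_ge_0_finite)
  have half: "real q / 2 \<le> real_of_int \<gamma> \<longleftrightarrow> int q \<le> 2 * \<gamma>"
    "real_of_int \<gamma> \<le> real q / 2 \<longleftrightarrow> 2 * \<gamma> \<le> int q" by linarith+
  show ?R if ?L
  proof -
    obtain C \<beta> where crc: "crc1 (hamming_vertices n A) (hamming_adj n) (hamming_degree n (card A)) C \<beta> \<gamma>"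
      and sum: "\<beta> + \<gamma> = 2 * int (card A)" and le: "\<gamma> \<le> \<beta>"
      using \<open>?L\<close> assms crc1_has_eigenvalue_hamming_2[of q n _ \<gamma>] by auto
    have \<gamma>: "1 \<le> \<gamma>" "\<gamma> \<le> int q" using crc sum le assms by (auto simp: crc1_def)
    obtain f x where f: "second_eigenvalue_code A {..<n} f \<gamma>" and x: "f x = 1"
      using second_eigenvalue_code_of_crc1[OF fin ne sum crc] by blast
    interpret second_eigenvalue_code A "{..<n}" f \<gamma> by (rule f)
    \<comment> \<open>The only line through the codeword \<open>x\<close> would have sum
      \<open>\<gamma> - q \<le> 0\<close>, although it contains a codeword.\<close>
    have "n \<noteq> 1"
    proof
      assume "n = 1"
      then have "line_sum A 0 f x = \<gamma> - int q" using lines[of x] x assms by simp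
      then show False using line_pos[OF x, of 0] \<gamma> by simp
    qed
    then have n: "n \<ge> 2" using assms by simp
    show ?R
    proof (cases "even \<gamma>")
      case True
      then show ?thesis using n \<gamma> by simp
    next
      case False
      have "n \<noteq> 2"
      proof
        assume "n = 2"
        then have "{..<n} = {0, 1}" by auto
        then show False using even_if_depends_on_two[of 0 1] depf False by simp
      qed
      then have "n \<ge> 3" using n by simp
      moreover have "even q"
      proof -
        have "2 * total f = \<gamma> * int (q ^ (n - 1))"
          using total_f \<open>n \<ge> 2\<close> assms by (simp add: lessThan_empty_iff)
        then have "even (\<gamma> * int (q ^ (n - 1)))" by (metis dvd_triv_left)
        then show ?thesis using False by simp
      qed
      \<comment> \<open>Odd values with \<open>q \<le> 2 \<gamma>\<close>, including equality, fall
        under the second alternative.\<close>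
      moreover have "condition1 (int q) \<gamma>" if "2 * \<gamma> < int q"
      proof -
        interpret sparse_second_eigenvalue_code A "{..<n}" f \<gamma>
          by unfold_locales (use that assms in simp)
        show ?thesis using condition1_if_odd[OF False] assms by simp
      qed
      ultimately show ?thesis using False \<gamma> unfolding half by linarith
    qed
  qed
  show ?L if ?R
  proof -
    \<comment> \<open>For \<open>\<beta> = 2 q - \<gamma>\<close> this is the required
      \<open>\<gamma> \<le> \<beta>\<close>.\<close>
    have "\<gamma> \<le> int q" using \<open>?R\<close> unfolding half by linarith
    have "\<exists>C. crc1 (hamming_vertices n A) (hamming_adj n) (hamming_degree n (card A)) C (2 * int (card A) - \<gamma>) \<gamma>"
      using \<open>?R\<close> unfolding half
    proof (elim disjE conjE)
      assume "n \<ge> 2" "even \<gamma>" "1 \<le> \<gamma>" "\<gamma> \<le> int q"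
      then show ?thesis using crc1_hamming_even[OF fin] assms by simp
    next
      assume *: "n \<ge> 3" "even q" "int q \<le> 2 * \<gamma>" "\<gamma> \<le> int q"
      then obtain h where "q = 2 * h" by blast
      then show ?thesis using * crc1_hamming_half[OF fin, of n h \<gamma>] assms by simp
    next
      assume "n \<ge> 3" "condition1 (int q) \<gamma>"
      then show ?thesis using crc1_hamming_condition1[OF fin, of n \<gamma>] \<open>\<gamma> \<le> int q\<close> assms by simp
    qed
    then obtain C where "crc1 (hamming_vertices n A) (hamming_adj n) (hamming_degree n q) C (2 * int q - \<gamma>) \<gamma>"
      using assms by auto
    moreover have "crc1_has_eigenvalue (hamming_degree n q) (2 * int q - \<gamma>) \<gamma> (hamming_eigenvalue 2 n q)"
      using crc1_has_eigenvalue_hamming_2[of q n] assms by simp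
    ultimately show ?L
      using \<open>\<gamma> \<le> int q\<close> by (intro exI[of _ C] exI[of _ "2 * int q - \<gamma>"]) simp
  qed
qed

end
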